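(* Let $Q$ be an interval, $C\ge1$, $\xi^\pm=\xi^\pm(C)$, and let $\varphi$ be such that $e^\varphi\in A_\infty^C(Q)$. Then for any $\lambda\in\mathbb R$ and any subinterval $J$ of $Q$, $$\frac1{|J|}\,\big|\{t\in J:~\varphi(t)-\langle\varphi\rangle_J\ge\lambda\}\big|\le \begin{cases} 1,& \lambda\le 0,\\[4pt] 1-\dfrac{\lambda}{\xi^+-\xi^-},& 0\le \lambda \le -\xi^-,\\[8pt] \dfrac{\xi^+e^{-\xi^-/\xi^+}}{\xi^+-\xi^-}\,e^{-\lambda/\xi^+},& \lambda\ge -\xi^-. \end{cases}$$ (For $C=1$ the right-hand side is understood as $1$ for $\lambda\le0$ and $0$ for $\lambda>0$.) This inequality is sharp for each value of $\lambda$, i.e., for each $C\ge1$ and $\lambda\in\mathbb R$ the right-hand side cannot be replaced by a smaller number depending only on $C$ and $\lambda$.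
   Context: For an interval $J$, $\langle\varphi\rangle_J=\frac1{|J|}\int_J\varphi$. An a.e. positive function $w$ is in $A_\infty(Q)$ if $w$ and $\log w$ are locally integrable and $[w]_{A_\infty(Q)}:=\sup_{J\subset Q}\langle w\rangle_Je^{-\langle\log w\rangle_J}<\infty$, the supremum being over all subintervals $J$ of the interval $Q$. For $C\ge1$, $A_\infty^C(Q)=\{w\in A_\infty(Q):[w]_{A_\infty(Q)}\le C\}$. For $C\ge1$, $\xi^\pm=\xi^\pm(C)$ are the two solutions of $e^{-\xi}=C(1-\xi)$ with $-\infty<\xi^-\le0\le\xi^+<1$ (both are $0$ when $C=1$). *)

theory Defs
  imports "HOL-Analysis.Analysis"
begin

text \<open>Intervals may be open, closed, half-open or unbounded, but never reduce to a point.\<close>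

definition nondegenerate_interval :: "real set \<Rightarrow> bool" where
  "nondegenerate_interval Q \<longleftrightarrow> is_interval Q \<and> interior Q \<noteq> {}"

text \<open>The subintervals over which averages are taken: they have finite positive length.\<close>

definition subintervals :: "real set \<Rightarrow> real set set" where
  "subintervals Q = {J. J \<subseteq> Q \<and> nondegenerate_interval J \<and> bounded J}"

definition average :: "real set \<Rightarrow> (real \<Rightarrow> real) \<Rightarrow> real" where
  "average J f = (LINT t:J|lebesgue. f t) / measure lebesgue J"

definition A_inf_char :: "real set \<Rightarrow> (real \<Rightarrow> real) \<Rightarrow> ereal" where
  "A_inf_char Q w =
     (SUP J\<in>subintervals Q. ereal (average J w * exp (- average J (\<lambda>t. ln (w t)))))"

text \<open>Integrability is required on every bounded subinterval, including those whose closure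
  is not contained in \<open>Q\<close>, so that every average entering the supremum is a genuine finite
  integral rather than the default value \<open>0\<close> of a non-integrable function.\<close>

definition A_inf :: "real set \<Rightarrow> (real \<Rightarrow> real) set" where
  "A_inf Q = {w. (AE t in lebesgue. t \<in> Q \<longrightarrow> 0 < w t)
     \<and> (\<forall>J\<in>subintervals Q. set_integrable lebesgue J w
          \<and> set_integrable lebesgue J (\<lambda>t. ln (w t)))
     \<and> A_inf_char Q w < \<infinity>}"

definition A_inf_le :: "real \<Rightarrow> real set \<Rightarrow> (real \<Rightarrow> real) set" where
  "A_inf_le C Q = {w \<in> A_inf Q. A_inf_char Q w \<le> ereal C}"

definition xi_plus :: "real \<Rightarrow> real" where
  "xi_plus C = (THE \<xi>. 0 \<le> \<xi> \<and> \<xi> < 1 \<and> exp (- \<xi>) = C * (1 - \<xi>))"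

definition xi_minus :: "real \<Rightarrow> real" where
  "xi_minus C = (THE \<xi>. \<xi> \<le> 0 \<and> exp (- \<xi>) = C * (1 - \<xi>))"

text \<open>The separate branch for \<open>C = 1\<close> is needed because then \<open>xi_plus C = xi_minus C = 0\<close>.\<close>

definition tail_bound :: "real \<Rightarrow> real \<Rightarrow> real" where
  "tail_bound C lam =
     (if lam \<le> 0 then 1
      else if C = 1 then 0
      else if lam \<le> - xi_minus C then 1 - lam / (xi_plus C - xi_minus C)
      else xi_plus C * exp (- xi_minus C / xi_plus C) / (xi_plus C - xi_minus C)
             * exp (- lam / xi_plus C))"

lemma xi_ratio_deriv:
  fixes x :: real
  assumes "x < 1"
  shows "((\<lambda>x. exp (- x) / (1 - x)) has_real_derivative x * exp (- x) / (1 - x)\<^sup>2) (at x)"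
  using assms
  by (auto intro!: derivative_eq_intros simp: field_simps power2_eq_square)

lemma xi_plus_ex1:
  assumes "1 \<le> C"
  shows "\<exists>!\<xi>::real. 0 \<le> \<xi> \<and> \<xi> < 1 \<and> exp (- \<xi>) = C * (1 - \<xi>)"
proof -
  have "\<exists>x\<ge>0. x \<le> 1 \<and> exp (- x) - C * (1 - x) = (0::real)"
    by (rule IVT') (use assms in \<open>auto intro!: continuous_intros\<close>)
  then obtain x :: real where x: "0 \<le> x" "x \<le> 1" "exp (- x) = C * (1 - x)" by auto
  have "x \<noteq> 1"
  proof
    assume "x = 1"
    with x(3) have "exp (- 1 :: real) = 0" by simp
    then show False by simp
  qed
  have False if ab: "0 \<le> a" "a < b" "b < 1" "exp (- a) = C * (1 - a)" "exp (- b) = C * (1 - b)"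
    for a b :: real
  proof -
    have "exp (- a) / (1 - a) < exp (- b) / (1 - b)"
    proof (rule DERIV_pos_imp_increasing_open[OF ab(2)])
      fix y assume "a < y" "y < b"
      then show "\<exists>d. ((\<lambda>x. exp (- x) / (1 - x)) has_real_derivative d) (at y) \<and> d > 0"
        using ab by (intro exI[of _ "y * exp (- y) / (1 - y)\<^sup>2"] conjI xi_ratio_deriv) auto
    next
      show "continuous_on {a..b} (\<lambda>x. exp (- x) / (1 - x))"
        using ab by (intro continuous_intros) auto
    qed
    with ab show False by simp
  qed
  with x \<open>x \<noteq> 1\<close> show ?thesis
    by (intro ex1I[of _ x]) (auto, metis linorder_neqE_linordered_idom order_le_less)
qed

lemma xi_minus_ex1:
  assumes "1 \<le> C"
  shows "\<exists>!\<xi>::real. \<xi> \<le> 0 \<and> exp (- \<xi>) = C * (1 - \<xi>)"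
proof -
  have e: "exp (2 * C) \<ge> C * (1 + 2 * C)"
    using exp_lower_Taylor_quadratic[of "2 * C"] assms by (simp add: algebra_simps power2_eq_square)
  have "\<exists>x\<ge>- 2 * C. x \<le> 0 \<and> exp (- x) - C * (1 - x) = (0::real)"
    by (rule IVT2') (use assms e in \<open>auto intro!: continuous_intros\<close>)
  then obtain x :: real where x: "x \<le> 0" "exp (- x) = C * (1 - x)" by auto
  have False if ab: "a < b" "b \<le> 0" "exp (- a) = C * (1 - a)" "exp (- b) = C * (1 - b)"
    for a b :: real
  proof -
    have "exp (- a) / (1 - a) > exp (- b) / (1 - b)"
    proof (rule DERIV_neg_imp_decreasing_open[OF ab(1)])
      fix y assume "a < y" "y < b"
      then show "\<exists>d. ((\<lambda>x. exp (- x) / (1 - x)) has_real_derivative d) (at y) \<and> d < 0"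
        using ab
        by (intro exI[of _ "y * exp (- y) / (1 - y)\<^sup>2"] conjI xi_ratio_deriv)
          (auto intro!: divide_neg_pos mult_neg_pos)
    next
      show "continuous_on {a..b} (\<lambda>x. exp (- x) / (1 - x))"
        using ab by (intro continuous_intros) auto
    qed
    with ab show False by simp
  qed
  with x show ?thesis
    by (intro ex1I[of _ x]) (auto, metis linorder_neqE_linordered_idom)
qed

end

theory Submission
  imports Defs
begin

text \<open>
  Write \<open>x\<close> and \<open>- y\<close> for the two roots. The convex function \<open>e\<^sup>p\<close> minus its tangent at
  \<open>m - x\<close> is nonnegative, so Markov's inequality for it on an interval of mean \<open>m\<close> bounds the
  proportion of \<open>{\<phi> \<ge> m + y}\<close> by \<open>x / (x + y)\<close>. For \<open>\<lambda> \<ge> y\<close> this is iterated: by the rising sun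
  lemma the part of an interval of mean below \<open>m\<close> where \<open>\<phi> > m\<close> is covered by disjoint intervals
  of mean exactly \<open>m\<close>, and on these, passing from the tangent at \<open>m - x\<close> to the one at \<open>m - \<delta> - x\<close>
  gains a factor \<open>1 - (1/x - 1) \<delta> + o(\<delta>)\<close>; letting \<open>\<delta>\<close> tend to \<open>0\<close> gives the exponential decay.
  For \<open>0 < \<lambda> < y\<close> one selects in the same way the intervals of mean \<open>u = m + \<lambda> - y\<close>, where the
  first bound applies at the level \<open>u + y = m + \<lambda>\<close>; outside of them \<open>\<phi> \<ge> u\<close>, and the indicator of
  \<open>{\<phi> \<ge> u + y}\<close> is at most \<open>(\<phi> - u + x) / (x + y)\<close>.

  Equality holds for a function on the half line that takes the values \<open>y\<close> and \<open>- x\<close> on \<open>(0, 1)\<close>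
  and continues as \<open>- x (1 + ln t)\<close>.
\<close>

section \<open>The rising sun lemma\<close>

lemma set_integral_Union_nonneg:
  fixes f :: "'a \<Rightarrow> real"
  assumes \<D>: "countable \<D>" "disjoint \<D>" "\<D> \<subseteq> sets M"
    and f: "set_integrable M (\<Union>\<D>) f"
    and nonneg: "\<And>D. D \<in> \<D> \<Longrightarrow> 0 \<le> (LINT t:D|M. f t)"
  shows "0 \<le> (LINT t:\<Union>\<D>|M. f t)"
proof -
  define \<F> where "\<F> n = {D \<in> \<D>. to_nat_on \<D> D < n}" for n
  have finite: "finite (\<F> n)" for n
    using finite_vimage_IntI[OF finite_lessThan inj_on_to_nat_on[OF \<D>(1)], of n]
    by (rule finite_subset[rotated]) (auto simp: \<F>_def)
  have sets: "\<Union>(\<F> n) \<in> sets M" for n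
    using finite \<D>(3) by (intro sets.finite_Union) (auto simp: \<F>_def)
  have union: "(\<Union>n. \<Union>(\<F> n)) = \<Union>\<D>"
    by (auto simp: \<F>_def)
  have integrable: "set_integrable M D f" if "D \<in> \<D>" for D
    using set_integrable_subset[OF f] that \<D>(3) by auto
  have "0 \<le> (LINT t:\<Union>(\<F> n)|M. f t)" for n
  proof -
    have "(LINT t:(\<Union>D\<in>\<F> n. D)|M. f t) = (\<Sum>D\<in>\<F> n. LINT t:D|M. f t)"
      using finite integrable \<D>(2,3)
      by (intro set_integral_finite_Union) (auto simp: \<F>_def disjoint_family_on_def disjoint_def)
    then show ?thesis using nonneg by (auto simp: \<F>_def intro!: sum_nonneg)
  qed
  moreover have "(\<lambda>n. LINT t:\<Union>(\<F> n)|M. f t) \<longlonglongrightarrow> (LINT t:(\<Union>n. \<Union>(\<F> n))|M. f t)"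
    by (rule set_integral_cont_up) (use sets f union in \<open>auto simp: incseq_def \<F>_def\<close>)
  ultimately show ?thesis
    unfolding union by (intro LIMSEQ_le_const) auto
qed

lemma nondegenerate_interval_closure_interior:
  fixes J :: "real set"
  assumes J: "nondegenerate_interval J" "bounded J"
  obtains a b where "a < b" "interior J = {a<..<b}" "closure J = {a..b}"
proof -
  have convex: "convex J" and connected: "connected J"
    using J(1) by (auto simp: nondegenerate_interval_def is_interval_convex is_interval_connected)
  have "connected (closure J) \<and> compact (closure J)"
    using connected J(2) by (simp add: connected_imp_connected_closure)
  then obtain a b where closure: "closure J = {a..b}"
    using connected_compact_interval_1 by blast
  then have interior: "interior J = {a<..<b}"
    using convex_interior_closure[OF convex] by simp
  then have "a < b"
    using J(1) by (auto simp: nondegenerate_interval_def)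
  then show ?thesis using that closure interior by blast
qed

lemma component_of_bounded_open_real:
  fixes S :: "real set"
  assumes S: "open S" "bounded S" and C: "C \<in> components S"
  obtains c d where "c < d" "C = {c<..<d}" "c \<notin> S" "d \<notin> S"
proof -
  have "open C" using open_components[OF S(1) C] .
  have "nondegenerate_interval C"
    using in_components_connected[OF C] in_components_nonempty[OF C] \<open>open C\<close>
    by (auto simp: nondegenerate_interval_def is_interval_connected_1 interior_open)
  moreover have "bounded C"
    using S(2) in_components_subset[OF C] by (rule bounded_subset)
  ultimately obtain c d where ends: "c < d" "C = {c<..<d}"
    using nondegenerate_interval_closure_interior[of C] \<open>open C\<close> by (metis interior_open)
  have "{c, d} = frontier C" using ends by (auto simp: frontier_def)
  also have "\<dots> \<subseteq> frontier S" by (rule frontier_of_components_subset[OF C])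
  finally have "c \<notin> S" "d \<notin> S" using S(1) by (auto simp: frontier_def interior_open)
  with ends show ?thesis using that by blast
qed

definition rising_shadow :: "real \<Rightarrow> real \<Rightarrow> (real \<Rightarrow> real) \<Rightarrow> real set" where
  "rising_shadow a b H = {t \<in> {a<..<b}. \<exists>s\<in>{t<..b}. H t < H s}"

lemma rising_shadow_subset: "rising_shadow a b H \<subseteq> {a<..<b}"
  by (auto simp: rising_shadow_def)

lemma bounded_rising_shadow: "bounded (rising_shadow a b H)"
  by (rule bounded_subset[OF bounded_closed_interval[of a b]]) (auto simp: rising_shadow_def)

lemma le_if_not_in_rising_shadow:
  assumes "t \<notin> rising_shadow a b H" "a < t" "t \<le> s" "s \<le> b"
  shows "H s \<le> H t"
  using assms by (cases "s = t") (auto simp: rising_shadow_def not_less)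

lemma open_rising_shadow:
  assumes "continuous_on {a..b} H"
  shows "open (rising_shadow a b H)"
proof -
  have shadow_eq: "rising_shadow a b H = (\<Union>s\<in>{..b}. {a<..<min b s} \<inter> H -` {..<H s})"
    by (auto simp: rising_shadow_def)
  show ?thesis
    unfolding shadow_eq
    by (intro open_UN ballI continuous_open_preimage continuous_on_subset[OF assms]) auto
qed

lemma le_right_end_of_rising_shadow:
  assumes H: "continuous_on {a..b} H" and "d \<le> b"
    and shadow: "{c<..<d} \<subseteq> rising_shadow a b H" "d \<notin> rising_shadow a b H" and t: "t \<in> {c<..<d}"
  shows "H t \<le> H d"
proof -
  have "a < t" using t shadow(1) rising_shadow_subset by fastforce
  have "continuous_on {t..b} H"
    using H by (rule continuous_on_subset) (use \<open>a < t\<close> in auto)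
  then obtain s where s: "s \<in> {t..b}" and max: "\<And>r. r \<in> {t..b} \<Longrightarrow> H r \<le> H s"
    using continuous_attains_sup[of "{t..b}" H] t \<open>d \<le> b\<close> by fastforce
  have "s \<notin> rising_shadow a b H"
    using s max by (auto simp: rising_shadow_def not_less)
  then have "s \<notin> {c<..<d}" using shadow(1) by blast
  then have "d \<le> s" using s t by auto
  have "H t \<le> H s" using max[of t] s by simp
  also have "H s \<le> H d"
    using le_if_not_in_rising_shadow[OF shadow(2) _ \<open>d \<le> s\<close>] \<open>a < t\<close> s t by simp
  finally show ?thesis .
qed

lemma rising_sun:
  assumes H: "continuous_on {a..b} H" and start: "\<And>t. t \<in> {a..b} \<Longrightarrow> H t \<le> H a"
    and C: "C \<in> components (rising_shadow a b H)"
  obtains c d where "a \<le> c" "c < d" "d \<le> b" "C = {c<..<d}" "H c = H d"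
proof -
  obtain c d where ends: "c < d" "C = {c<..<d}"
      "c \<notin> rising_shadow a b H" "d \<notin> rising_shadow a b H"
    using component_of_bounded_open_real[OF open_rising_shadow[OF H] _ C]
      bounded_rising_shadow by blast
  have shadow: "{c<..<d} \<subseteq> rising_shadow a b H"
    using in_components_subset[OF C] ends(2) by simp
  then have "{c<..<d} \<subseteq> {a<..<b}" using rising_shadow_subset by blast
  then have bounds: "a \<le> c" "d \<le> b"
    using ends(1) by (auto simp: greaterThanLessThan_subseteq_greaterThanLessThan)
  have "H d \<le> H c"
    using start[of d] le_if_not_in_rising_shadow[OF ends(3), of d] ends(1) bounds
    by (cases "c = a") auto
  moreover have "H c \<le> H d"
  proof (rule tendsto_upperbound)
    show "(H \<longlongrightarrow> H c) (at_right c)"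
      using continuous_on_Icc_at_rightD[of c d H] continuous_on_subset[OF H] ends(1) bounds by auto
    show "\<forall>\<^sub>F t in at_right c. H t \<le> H d"
      using le_right_end_of_rising_shadow[OF H bounds(2) shadow ends(4)] ends(1)
      unfolding eventually_at_right_field by (intro exI[of _ d]) auto
  qed simp
  ultimately show ?thesis using that ends(1,2) bounds by simp
qed

lemma integral_Icc_diff:
  fixes f :: "real \<Rightarrow> 'a::banach"
  assumes "f integrable_on {a..b}" "a \<le> c" "c \<le> d" "d \<le> b"
  shows "integral {c..d} f = integral {a..d} f - integral {a..c} f"
  using Henstock_Kurzweil_Integration.integral_combine[of a c d f]
    integrable_on_subinterval[OF assms(1), of a d] assms by (auto simp: algebra_simps)

lemma negligible_pos_of_integral_nonpos:
  fixes h :: "real \<Rightarrow> real"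
  assumes h: "h integrable_on {a..b}" and K: "K \<subseteq> {a..<b}"
    and nonpos: "\<And>t s. \<lbrakk>t \<in> K; t < s; s \<le> b\<rbrakk> \<Longrightarrow> integral {t..s} h \<le> 0"
  shows "negligible {t \<in> K. 0 < h t}"
proof -
  define g where "g t = (if t \<in> {a..b} then h t else 0)" for t
  have "g integrable_on UNIV"
    using h unfolding g_def by (simp only: integrable_restrict_UNIV)
  then have "g integrable_on cbox c d" for c d
    by (rule integrable_on_subcbox) simp
  \<comment> \<open>Lebesgue's differentiation theorem, from the right\<close>
  then obtain N where N: "negligible N"
    and deriv: "\<And>t e. \<lbrakk>t \<notin> N; 0 < e\<rbrakk> \<Longrightarrow>
      \<exists>\<delta>>0. \<forall>r. 0 < r \<and> r < \<delta> \<longrightarrow> \<bar>integral {t..t + r} g / r - g t\<bar> < e"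
    using integrable_ccontinuous_explicit[of g] by (auto simp: divide_inverse mult.commute)
  have "h t \<le> 0" if t: "t \<in> K" "t \<notin> N" for t
  proof (rule ccontr)
    assume "\<not> h t \<le> 0"
    then obtain \<delta> where \<delta>: "0 < \<delta>"
        "\<And>r. \<lbrakk>0 < r; r < \<delta>\<rbrakk> \<Longrightarrow> \<bar>integral {t..t + r} g / r - g t\<bar> < h t"
      using deriv[of t "h t"] t by auto
    define r where "r = min (\<delta> / 2) (b - t)"
    have r: "0 < r" "r < \<delta>" "t + r \<le> b"
      using \<delta>(1) t K by (auto simp: r_def min_def)
    have "integral {t..t + r} g = integral {t..t + r} h"
      using t K r by (intro integral_cong) (auto simp: g_def)
    then have "integral {t..t + r} g / r \<le> 0"
      using nonpos[of t "t + r"] t r by (simp add: divide_nonpos_pos)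
    moreover have "g t = h t" using t K by (auto simp: g_def)
    ultimately show False using \<delta>(2)[of r] r by auto
  qed
  then show ?thesis
    by (intro negligible_subset[OF N]) force
qed

lemma AE_nonpos_off_rising_shadow:
  fixes h :: "real \<Rightarrow> real"
  assumes h: "h integrable_on {a..b}"
  shows "AE t in lebesgue. t \<in> {a..b} - rising_shadow a b (\<lambda>t. integral {a..t} h) \<longrightarrow> h t \<le> 0"
proof -
  let ?S = "rising_shadow a b (\<lambda>t. integral {a..t} h)"
  have "negligible {t \<in> {a<..<b} - ?S. 0 < h t}"
  proof (rule negligible_pos_of_integral_nonpos[OF h])
    fix t s assume "t \<in> {a<..<b} - ?S" "t < s" "s \<le> b"
    then show "integral {t..s} h \<le> 0"
      using integral_Icc_diff[OF h, of t s]
        le_if_not_in_rising_shadow[of t a b "\<lambda>t. integral {a..t} h" s] by simp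
  qed auto
  then have "negligible ({a, b} \<union> {t \<in> {a<..<b} - ?S. 0 < h t})"
    by (simp add: negligible_insert)
  then have "AE t in lebesgue. t \<notin> {a, b} \<union> {t \<in> {a<..<b} - ?S. 0 < h t}"
    unfolding negligible_iff_null_sets by (rule AE_not_in)
  then show ?thesis by eventually_elim auto
qed

lemma set_integral_rising_shadow_nonneg:
  fixes f :: "real \<Rightarrow> real"
  assumes H: "continuous_on {a..b} H" and start: "\<And>t. t \<in> {a..b} \<Longrightarrow> H t \<le> H a"
    and f: "f absolutely_integrable_on {a..b}"
    and block: "\<And>c d. \<lbrakk>a \<le> c; c < d; d \<le> b; H c = H d\<rbrakk> \<Longrightarrow> 0 \<le> integral {c..d} f"
  shows "0 \<le> (LINT t:rising_shadow a b H|lebesgue. f t)"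
proof -
  let ?S = "rising_shadow a b H"
  have S: "open ?S" by (rule open_rising_shadow[OF H])
  have "?S \<subseteq> {a..b}" using rising_shadow_subset[of a b H] by auto
  then have f_on: "set_integrable lebesgue D f" if "open D" "D \<subseteq> ?S" for D
    using that by (intro set_integrable_subset[OF f]) auto
  have "0 \<le> (LINT t:\<Union>(components ?S)|lebesgue. f t)"
  proof (rule set_integral_Union_nonneg)
    show disjoint: "disjoint (components ?S)"
      using components_nonoverlap by (auto simp: disjoint_def)
    show "countable (components ?S)"
      using open_components[OF S] disjoint by (intro countable_disjoint_open_subsets)
    show "components ?S \<subseteq> sets lebesgue"
      using open_components[OF S] by auto
    show "set_integrable lebesgue (\<Union>(components ?S)) f"
      using f_on[OF S] by simp
    fix C assume C: "C \<in> components ?S"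
    then obtain c d where "a \<le> c" "c < d" "d \<le> b" "C = {c<..<d}" "H c = H d"
      using rising_sun[OF H start] by blast
    then have "0 \<le> integral C f"
      using block by (simp add: integral_open_interval_real)
    also have "\<dots> = (LINT t:C|lebesgue. f t)"
      using f_on[OF open_components[OF S C] in_components_subset[OF C]]
      by (rule set_lebesgue_integral_eq_integral(2)[symmetric])
    finally show "0 \<le> (LINT t:C|lebesgue. f t)" .
  qed
  then show ?thesis by simp
qed

lemma rising_sun_integral_nonneg_if_primitive_nonpos:
  fixes f h :: "real \<Rightarrow> real"
  assumes h: "h integrable_on {a..b}" and f: "f absolutely_integrable_on {a..b}"
    and primitive: "\<And>t. t \<in> {a..b} \<Longrightarrow> integral {a..t} h \<le> 0"
    and pointwise: "\<And>t. \<lbrakk>t \<in> {a..b}; h t \<le> 0\<rbrakk> \<Longrightarrow> 0 \<le> f t"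
    and block: "\<And>c d. \<lbrakk>a \<le> c; c < d; d \<le> b; integral {c..d} h = 0\<rbrakk> \<Longrightarrow> 0 \<le> integral {c..d} f"
  shows "0 \<le> integral {a..b} f"
proof -
  define S where "S = rising_shadow a b (\<lambda>t. integral {a..t} h)"
  have H: "continuous_on {a..b} (\<lambda>t. integral {a..t} h)"
    by (rule indefinite_integral_continuous_1[OF h])
  have S: "S \<in> sets lebesgue" "S \<subseteq> {a..b}"
    using open_rising_shadow[OF H] rising_shadow_subset by (force simp: S_def)+
  have "0 \<le> (LINT t:S|lebesgue. f t)"
    unfolding S_def
  proof (rule set_integral_rising_shadow_nonneg[OF H _ f])
    show "0 \<le> integral {c..d} f"
      if "a \<le> c" "c < d" "d \<le> b" "integral {a..c} h = integral {a..d} h" for c d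
      using block[of c d] integral_Icc_diff[OF h, of c d] that by simp
  qed (use primitive in simp)
  moreover have "0 \<le> (LINT t:{a..b} - S|lebesgue. f t)"
    unfolding set_lebesgue_integral_def
  proof (rule integral_nonneg_AE)
    show "AE t in lebesgue. 0 \<le> indicator ({a..b} - S) t *\<^sub>R f t"
      using AE_nonpos_off_rising_shadow[OF h]
    proof eventually_elim
      case (elim t)
      then show ?case using pointwise[of t] by (cases "t \<in> {a..b} - S") (auto simp: S_def)
    qed
  qed
  moreover have "(LINT t:S \<union> ({a..b} - S)|lebesgue. f t)
      = (LINT t:S|lebesgue. f t) + (LINT t:{a..b} - S|lebesgue. f t)"
    using S by (intro set_integral_Un set_integrable_subset[OF f]) auto
  moreover have "S \<union> ({a..b} - S) = {a..b}" using S(2) by auto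
  ultimately show ?thesis
    using set_lebesgue_integral_eq_integral(2)[OF f] by simp
qed

lemma last_return_to_start:
  fixes H :: "real \<Rightarrow> real"
  assumes "a \<le> b" and H: "continuous_on {a..b} H" and "H b \<le> H a"
  obtains z where "a \<le> z" "z \<le> b" "H z = H a" "\<And>t. t \<in> {z..b} \<Longrightarrow> H t \<le> H a"
proof -
  define Z where "Z = {t \<in> {a..b}. H t = H a}"
  have Z: "closed Z" "bdd_above Z" "a \<in> Z"
    using continuous_closed_preimage_constant[OF H, of "H a"] \<open>a \<le> b\<close>
    by (auto simp: Z_def bdd_above_def)
  define z where "z = Sup Z"
  have "z \<in> Z" unfolding z_def using Z by (intro closed_contains_Sup) auto
  then have z: "a \<le> z" "z \<le> b" "H z = H a" by (auto simp: Z_def)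
  have "H t \<le> H a" if t: "t \<in> {z..b}" for t
  proof (rule ccontr)
    assume above: "\<not> H t \<le> H a"
    have "\<exists>s\<ge>t. s \<le> b \<and> H s = H a"
      using above \<open>H b \<le> H a\<close> t z continuous_on_subset[OF H, of "{t..b}"]
      by (intro IVT2') auto
    then obtain s where "t \<le> s" "s \<in> Z" using t z by (auto simp: Z_def)
    then have "t = z" using t cSup_upper[OF _ Z(2)] unfolding z_def by fastforce
    with above z show False by simp
  qed
  with z show ?thesis by (rule that)
qed

lemma rising_sun_integral_nonneg:
  fixes f h :: "real \<Rightarrow> real"
  assumes "a \<le> b" and h: "h integrable_on {a..b}" and f: "f absolutely_integrable_on {a..b}"
    and total: "integral {a..b} h \<le> 0"
    and pointwise: "\<And>t. \<lbrakk>t \<in> {a..b}; h t \<le> 0\<rbrakk> \<Longrightarrow> 0 \<le> f t"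
    and block: "\<And>c d. \<lbrakk>a \<le> c; c < d; d \<le> b; integral {c..d} h = 0\<rbrakk> \<Longrightarrow> 0 \<le> integral {c..d} f"
  shows "0 \<le> integral {a..b} f"
proof -
  obtain z where z: "a \<le> z" "z \<le> b" "integral {a..z} h = 0"
      "\<And>t. t \<in> {z..b} \<Longrightarrow> integral {a..t} h \<le> 0"
    using last_return_to_start[OF \<open>a \<le> b\<close> indefinite_integral_continuous_1[OF h]] total by auto
  have "0 \<le> integral {a..z} f"
    using block[of a z] z by (cases "a = z") auto
  moreover have "0 \<le> integral {z..b} f"
  proof (rule rising_sun_integral_nonneg_if_primitive_nonpos[where h = h])
    show "h integrable_on {z..b}" "f absolutely_integrable_on {z..b}"
      using integrable_on_subinterval[OF h] set_integrable_subset[OF f] z(1,2) by auto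
    show "integral {z..t} h \<le> 0" if "t \<in> {z..b}" for t
      using integral_Icc_diff[OF h, of z t] z that by simp
  qed (use pointwise block z(1,2) in auto)
  moreover have "integral {z..b} f = integral {a..b} f - integral {a..z} f"
    using f set_lebesgue_integral_eq_integral(1) z(1,2) by (intro integral_Icc_diff) auto
  ultimately show ?thesis by simp
qed

lemma rising_sun_measure_le:
  fixes g h :: "real \<Rightarrow> real"
  assumes E: "E \<in> sets lebesgue" and "a \<le> b"
    and h: "h integrable_on {a..b}" and g: "g absolutely_integrable_on {a..b}"
    and total: "integral {a..b} h \<le> 0"
    and pointwise: "\<And>t. \<lbrakk>t \<in> {a..b}; h t \<le> 0\<rbrakk> \<Longrightarrow> indicator E t \<le> g t"
    and block: "\<And>c d. \<lbrakk>a \<le> c; c < d; d \<le> b; integral {c..d} h = 0\<rbrakk>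
      \<Longrightarrow> measure lebesgue (E \<inter> {c..d}) \<le> integral {c..d} g"
  shows "measure lebesgue (E \<inter> {a..b}) \<le> integral {a..b} g"
proof -
  have E_on: "E \<inter> {c..d} \<in> lmeasurable" for c d
    using E by (intro bounded_set_imp_lmeasurable) auto
  have indicator: "indicat_real E absolutely_integrable_on {c..d}" for c d
    using E_on[of c d] unfolding set_integrable_def Int_commute[of E]
    by (auto simp: fmeasurable_def simp flip: indicator_inter_arith)
  have integral_diff: "integral {c..d} (\<lambda>t. g t - indicator E t)
      = integral {c..d} g - measure lebesgue (E \<inter> {c..d})" if "a \<le> c" "d \<le> b" for c d
  proof -
    have "g absolutely_integrable_on {c..d}"
      using set_integrable_subset[OF g] that by auto
    then have "integral {c..d} (\<lambda>t. g t - indicator E t)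
        = integral {c..d} g - integral {c..d} (indicator E)"
      using indicator set_lebesgue_integral_eq_integral(1)
      by (intro Henstock_Kurzweil_Integration.integral_diff) auto
    then show ?thesis by (simp only: integral_indicator[OF E_on])
  qed
  have "0 \<le> integral {a..b} (\<lambda>t. g t - indicator E t)"
  proof (rule rising_sun_integral_nonneg[OF \<open>a \<le> b\<close> h _ total])
    show "(\<lambda>t. g t - indicator E t) absolutely_integrable_on {a..b}"
      using g indicator by (rule set_integral_diff)
  qed (use pointwise block integral_diff in auto)
  then show ?thesis using integral_diff by simp
qed

section \<open>Superlevel sets\<close>

lemma superlevel_lmeasurable:
  fixes f :: "'a::euclidean_space \<Rightarrow> real"
  assumes f: "f absolutely_integrable_on S" and S: "S \<in> lmeasurable"
  shows "{t \<in> S. l \<le> f t} \<in> lmeasurable"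
proof (rule fmeasurableI2[OF S])
  have "f \<in> borel_measurable (lebesgue_on S)"
    using f S absolutely_integrable_measurable by blast
  then have "{t \<in> space (lebesgue_on S). l \<le> f t} \<in> sets (lebesgue_on S)"
    by measurable
  then show "{t \<in> S. l \<le> f t} \<in> sets lebesgue"
    using S by (simp add: sets_restrict_space_iff fmeasurableD)
qed auto

definition superlevel_measure :: "real \<Rightarrow> real \<Rightarrow> (real \<Rightarrow> real) \<Rightarrow> real \<Rightarrow> real" where
  "superlevel_measure a b f l = measure lebesgue {t \<in> {a..b}. l \<le> f t}"

lemma superlevel_measure_le_length:
  assumes "f absolutely_integrable_on {a..b}" "a \<le> b"
  shows "superlevel_measure a b f l \<le> b - a"
proof -
  have "{t \<in> {a..b}. l \<le> f t} \<in> lmeasurable"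
    using assms(1) by (rule superlevel_lmeasurable) simp
  then have "superlevel_measure a b f l \<le> measure lebesgue {a..b}"
    unfolding superlevel_measure_def by (intro measure_mono_fmeasurable fmeasurableD) auto
  then show ?thesis using assms(2) by simp
qed

lemma superlevel_measure_const:
  assumes "a \<le> b"
  shows "superlevel_measure a b (\<lambda>_. k) l = (if l \<le> k then b - a else 0)"
proof -
  have "{t \<in> {a..b}. l \<le> k} = (if l \<le> k then {a..b} else {})" by auto
  then show ?thesis using assms by (simp add: superlevel_measure_def)
qed

lemma superlevel_measure_mono:
  assumes f: "f absolutely_integrable_on {a..b}" and g: "g absolutely_integrable_on {a..b}"
    and imp: "\<And>t. \<lbrakk>t \<in> {a..b}; l \<le> f t\<rbrakk> \<Longrightarrow> k \<le> g t"
  shows "superlevel_measure a b f l \<le> superlevel_measure a b g k"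
  unfolding superlevel_measure_def
proof (rule measure_mono_fmeasurable)
  show "{t \<in> {a..b}. l \<le> f t} \<in> sets lebesgue"
    using f by (intro fmeasurableD superlevel_lmeasurable) auto
  show "{t \<in> {a..b}. k \<le> g t} \<in> lmeasurable"
    using g by (rule superlevel_lmeasurable) simp
qed (use imp in auto)

lemma superlevel_measure_Markov:
  assumes f: "f absolutely_integrable_on {a..b}" "\<And>t. t \<in> {a..b} \<Longrightarrow> 0 \<le> f t" and "0 < l"
  shows "superlevel_measure a b f l \<le> integral {a..b} f / l"
proof -
  have "superlevel_measure a b f l \<le> (LINT t:{a..b}|lebesgue. f t) / l"
    unfolding superlevel_measure_def using assms
    by (intro integral_Markov_inequality'_measure) auto
  then show ?thesis by (simp only: set_lebesgue_integral_eq_integral(2)[OF f(1)])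
qed

lemma integral_diff_const:
  fixes f :: "real \<Rightarrow> real"
  assumes "f integrable_on {a..b}" "a \<le> b"
  shows "integral {a..b} (\<lambda>t. f t - u) = integral {a..b} f - u * (b - a)"
  using assms by (simp add: Henstock_Kurzweil_Integration.integral_diff integrable_const_ivl)

text \<open>The blocks cover the set where \<open>\<kappa> (f - u) > 0\<close>; both signs of \<open>\<kappa>\<close> are needed.\<close>

lemma superlevel_measure_le_of_mean_blocks:
  fixes f g :: "real \<Rightarrow> real"
  assumes "a \<le> b" "\<kappa> \<noteq> 0"
    and f: "f absolutely_integrable_on {a..b}" and g: "g absolutely_integrable_on {a..b}"
    and total: "\<kappa> * (integral {a..b} f - u * (b - a)) \<le> 0"
    and pointwise: "\<And>t. \<lbrakk>t \<in> {a..b}; \<kappa> * (f t - u) \<le> 0\<rbrakk> \<Longrightarrow> of_bool (l \<le> f t) \<le> g t"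
    and block: "\<And>c d. \<lbrakk>a \<le> c; c < d; d \<le> b; integral {c..d} f = u * (d - c)\<rbrakk>
      \<Longrightarrow> superlevel_measure c d f l \<le> integral {c..d} g"
  shows "superlevel_measure a b f l \<le> integral {a..b} g"
proof -
  define E where "E = {t \<in> {a..b}. l \<le> f t}"
  have E_on: "superlevel_measure c d f l = measure lebesgue (E \<inter> {c..d})"
    if "a \<le> c" "d \<le> b" for c d
    unfolding superlevel_measure_def E_def using that
    by (intro arg_cong[where f = "measure lebesgue"]) auto
  have integrable: "f integrable_on {a..b}"
    using f by (rule set_lebesgue_integral_eq_integral(1))
  have integral_h: "integral {c..d} (\<lambda>t. \<kappa> * (f t - u)) = \<kappa> * (integral {c..d} f - u * (d - c))"
    if "a \<le> c" "c \<le> d" "d \<le> b" for c d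
    using that integrable_on_subinterval[OF integrable, of c d] by (simp add: integral_diff_const)
  have "measure lebesgue (E \<inter> {a..b}) \<le> integral {a..b} g"
  proof (rule rising_sun_measure_le[OF _ \<open>a \<le> b\<close> _ g])
    show "E \<in> sets lebesgue"
      unfolding E_def using f by (intro fmeasurableD superlevel_lmeasurable) auto
    show "(\<lambda>t. \<kappa> * (f t - u)) integrable_on {a..b}"
      using integrable by (intro integrable_on_mult_right integrable_diff integrable_const_ivl)
    show "integral {a..b} (\<lambda>t. \<kappa> * (f t - u)) \<le> 0"
      unfolding integral_h[OF order_refl \<open>a \<le> b\<close> order_refl] by (rule total)
    show "indicator E t \<le> g t" if "t \<in> {a..b}" "\<kappa> * (f t - u) \<le> 0" for t
      using pointwise[OF that] that(1) by (simp add: E_def indicator_def of_bool_def)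
    fix c d assume sub: "a \<le> c" "c < d" "d \<le> b" and "integral {c..d} (\<lambda>t. \<kappa> * (f t - u)) = 0"
    then have "integral {c..d} f = u * (d - c)"
      using integral_h[of c d] \<open>\<kappa> \<noteq> 0\<close> by simp
    then show "measure lebesgue (E \<inter> {c..d}) \<le> integral {c..d} g"
      using block[OF sub] by (simp only: E_on[OF sub(1,3)])
  qed
  then show ?thesis by (simp only: E_on[OF order_refl order_refl])
qed

section \<open>Logarithms of weights and tangents to the exponential\<close>

definition log_A_inf_on :: "real \<Rightarrow> real \<Rightarrow> real \<Rightarrow> (real \<Rightarrow> real) \<Rightarrow> bool" where
  "log_A_inf_on C a b \<phi> \<longleftrightarrow>
     \<phi> absolutely_integrable_on {a..b} \<and> (\<lambda>t. exp (\<phi> t)) absolutely_integrable_on {a..b} \<and>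
     (\<forall>c d. a \<le> c \<longrightarrow> c < d \<longrightarrow> d \<le> b \<longrightarrow>
        integral {c..d} (\<lambda>t. exp (\<phi> t)) \<le> C * (d - c) * exp (integral {c..d} \<phi> / (d - c)))"

lemma log_A_inf_onD:
  assumes "log_A_inf_on C a b \<phi>"
  shows "\<phi> absolutely_integrable_on {a..b}" "\<phi> integrable_on {a..b}"
    and "(\<lambda>t. exp (\<phi> t)) absolutely_integrable_on {a..b}" "(\<lambda>t. exp (\<phi> t)) integrable_on {a..b}"
  using assms set_lebesgue_integral_eq_integral(1) by (auto simp: log_A_inf_on_def)

lemma log_A_inf_on_mean:
  assumes "log_A_inf_on C a b \<phi>" "a < b" "integral {a..b} \<phi> = m * (b - a)"
  shows "integral {a..b} (\<lambda>t. exp (\<phi> t)) \<le> C * (b - a) * exp m"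
  using assms by (force simp: log_A_inf_on_def)

lemma log_A_inf_on_subinterval:
  assumes "log_A_inf_on C a b \<phi>" "a \<le> c" "d \<le> b"
  shows "log_A_inf_on C c d \<phi>"
proof -
  have "f absolutely_integrable_on {c..d}" if "f absolutely_integrable_on {a..b}"
    for f :: "real \<Rightarrow> real"
    using set_integrable_subset[OF that, of "{c..d}"] assms(2,3) by auto
  then show ?thesis using assms by (auto simp: log_A_inf_on_def)
qed

definition exp_tangent_gap :: "real \<Rightarrow> real \<Rightarrow> real" where
  "exp_tangent_gap r p = exp p - exp r * (1 + p - r)"

lemma exp_tangent_le: "exp r * (1 + p - r) \<le> exp (p :: real)"
proof -
  have "exp r * (1 + (p - r)) \<le> exp r * exp (p - r)"
    by (intro mult_left_mono exp_ge_add_one_self) auto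
  then show ?thesis by (simp add: algebra_simps flip: exp_add)
qed

lemma exp_tangent_gap_nonneg: "0 \<le> exp_tangent_gap r p"
  using exp_tangent_le by (simp add: exp_tangent_gap_def)

lemma exp_tangent_gap_mono:
  assumes "r \<le> s" "s \<le> p"
  shows "exp_tangent_gap r s \<le> exp_tangent_gap r p"
proof -
  have "exp r * (p - s) \<le> exp s * (p - s)"
    using assms by (intro mult_right_mono) auto
  then show ?thesis
    using exp_tangent_le[of s p] by (simp add: exp_tangent_gap_def algebra_simps)
qed

lemma exp_tangent_gap_pos:
  assumes "r < p"
  shows "0 < exp_tangent_gap r p"
proof -
  have "1 + (p - r) + (p - r)\<^sup>2 / 2 \<le> exp (p - r)"
    using assms by (intro exp_lower_Taylor_quadratic) simp
  moreover have "0 < (p - r)\<^sup>2" using assms by simp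
  ultimately have "1 + (p - r) < exp (p - r)" by linarith
  then have "exp r * (1 + (p - r)) < exp r * exp (p - r)" by simp
  then show ?thesis by (simp add: exp_tangent_gap_def algebra_simps flip: exp_add)
qed

lemma absolutely_integrable_exp_tangent_gap:
  assumes "log_A_inf_on C a b \<phi>"
  shows "(\<lambda>t. exp_tangent_gap r (\<phi> t)) absolutely_integrable_on {a..b}"
  unfolding exp_tangent_gap_def using log_A_inf_onD[OF assms]
  by (intro set_integral_diff set_integral_add set_integrable_mult_right
      absolutely_integrable_on_const) auto

lemma integral_exp_tangent_gap:
  assumes \<phi>: "log_A_inf_on C a b \<phi>" "a < b" "integral {a..b} \<phi> = m * (b - a)"
  shows "integral {a..b} (\<lambda>t. exp_tangent_gap r (\<phi> t))
    = integral {a..b} (\<lambda>t. exp (\<phi> t)) - exp r * (1 + m - r) * (b - a)"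
proof -
  have gap_eq: "exp_tangent_gap r p = exp p - exp r * (p - (r - 1))" for p
    by (simp add: exp_tangent_gap_def algebra_simps)
  have "(\<lambda>t. \<phi> t - (r - 1)) integrable_on {a..b}"
    using log_A_inf_onD(2)[OF \<phi>(1)] by (intro integrable_diff integrable_const_ivl)
  then have "integral {a..b} (\<lambda>t. exp_tangent_gap r (\<phi> t))
      = integral {a..b} (\<lambda>t. exp (\<phi> t)) - exp r * integral {a..b} (\<lambda>t. \<phi> t - (r - 1))"
    unfolding gap_eq using log_A_inf_onD(4)[OF \<phi>(1)]
    by (simp add: Henstock_Kurzweil_Integration.integral_diff integrable_on_mult_right)
  also have "integral {a..b} (\<lambda>t. \<phi> t - (r - 1)) = (1 + m - r) * (b - a)"
    unfolding integral_diff_const[OF log_A_inf_onD(2)[OF \<phi>(1)] less_imp_le[OF \<phi>(2)]] \<phi>(3)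
    by (simp add: algebra_simps)
  finally show ?thesis by simp
qed

lemma integral_exp_tangent_gap_le:
  assumes "log_A_inf_on C a b \<phi>" "a < b" "integral {a..b} \<phi> = m * (b - a)"
  shows "integral {a..b} (\<lambda>t. exp_tangent_gap r (\<phi> t))
    \<le> (C * exp m - exp r * (1 + m - r)) * (b - a)"
  unfolding integral_exp_tangent_gap[OF assms]
  using log_A_inf_on_mean[OF assms] by (simp add: algebra_simps)

lemma superlevel_measure_le_integral_gap:
  assumes \<phi>: "log_A_inf_on C a b \<phi>" and "r < s"
  shows "superlevel_measure a b \<phi> s
    \<le> integral {a..b} (\<lambda>t. exp_tangent_gap r (\<phi> t)) / exp_tangent_gap r s"
proof -
  note gap = absolutely_integrable_exp_tangent_gap[OF \<phi>, of r]
  have "superlevel_measure a b \<phi> s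
      \<le> superlevel_measure a b (\<lambda>t. exp_tangent_gap r (\<phi> t)) (exp_tangent_gap r s)"
    using log_A_inf_onD(1)[OF \<phi>] gap \<open>r < s\<close>
    by (intro superlevel_measure_mono exp_tangent_gap_mono) auto
  also have "\<dots> \<le> integral {a..b} (\<lambda>t. exp_tangent_gap r (\<phi> t)) / exp_tangent_gap r s"
    using gap exp_tangent_gap_nonneg exp_tangent_gap_pos[OF \<open>r < s\<close>]
    by (rule superlevel_measure_Markov)
  finally show ?thesis .
qed

lemma superlevel_measure_eq_0_if_constant_1:
  assumes \<phi>: "log_A_inf_on 1 a b \<phi>" "a < b" "integral {a..b} \<phi> = m * (b - a)" and "0 < lam"
  shows "superlevel_measure a b \<phi> (m + lam) = 0"
proof (rule antisym)
  have "superlevel_measure a b \<phi> (m + lam)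
      \<le> integral {a..b} (\<lambda>t. exp_tangent_gap m (\<phi> t)) / exp_tangent_gap m (m + lam)"
    using \<open>0 < lam\<close> by (intro superlevel_measure_le_integral_gap[OF \<phi>(1)]) simp
  also have "\<dots> \<le> 0"
    using integral_exp_tangent_gap_le[OF \<phi>, of m] exp_tangent_gap_nonneg
    by (intro divide_nonpos_nonneg) simp_all
  finally show "superlevel_measure a b \<phi> (m + lam) \<le> 0" .
qed (simp only: superlevel_measure_def measure_nonneg)

section \<open>Upper bounds\<close>

lemma power_tendsto_exp_of_derivative:
  fixes f :: "real \<Rightarrow> real"
  assumes f: "(f has_real_derivative r) (at 0)" "f 0 = 1"
  shows "(\<lambda>n. f (L / real n) ^ n) \<longlonglongrightarrow> exp (L * r)"
proof (cases "L = 0")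
  case False
  have "filterlim (\<lambda>n. L / real n) (at 0) sequentially"
    using False eventually_gt_at_top[of "0::nat"]
    by (intro filterlim_atI lim_const_over_n) (auto elim: eventually_mono)
  note compose = filterlim_compose[OF _ this]
  have "((\<lambda>h. ln (f h)) has_real_derivative r) (at 0)"
    using DERIV_chain2[OF DERIV_ln_divide f(1)] f(2) by simp
  then have "((\<lambda>h. ln (f h) / h) \<longlongrightarrow> r) (at 0)"
    by (simp add: DERIV_def f(2))
  then have limit: "(\<lambda>n. exp (L * (ln (f (L / real n)) / (L / real n)))) \<longlonglongrightarrow> exp (L * r)"
    by (intro tendsto_intros compose)
  have "(f \<longlongrightarrow> 1) (at 0)"
    using DERIV_isCont[OF f(1)] f(2) by (simp add: isCont_def)
  then have "\<forall>\<^sub>F n in sequentially. 0 < f (L / real n)"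
    using order_tendstoD(1)[OF compose] by force
  then have "\<forall>\<^sub>F n in sequentially.
      exp (L * (ln (f (L / real n)) / (L / real n))) = f (L / real n) ^ n"
    using eventually_gt_at_top[of 0]
    by eventually_elim (use False in \<open>simp add: exp_of_nat2_mult\<close>)
  with limit show ?thesis by (rule Lim_transform_eventually)
qed (simp add: f(2))

locale tangent_pair =
  fixes C x y :: real
  assumes x_pos: "0 < x" and x_less_1: "x < 1" and y_pos: "0 < y"
    and exp_x: "exp (- x) = C * (1 - x)" and exp_y: "exp y = C * (1 + y)"
begin

lemma C_pos: "0 < C"
proof -
  have "0 < C * (1 + y)" by (simp flip: exp_y)
  then show ?thesis using y_pos by (simp add: zero_less_mult_iff)
qed

lemma exp_diff_x: "exp (m - x) = C * (1 - x) * exp m"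
  by (simp add: exp_x[symmetric] flip: exp_add)

lemma exp_tangent_gap_across: "exp_tangent_gap (m - x) (m + y) = C * x * (x + y) * exp m"
proof -
  have "exp (m + y) = C * (1 + y) * exp m" by (simp add: exp_add exp_y)
  then show ?thesis by (simp add: exp_tangent_gap_def exp_diff_x algebra_simps)
qed

lemma integral_gap_at_mean_le:
  assumes "log_A_inf_on C a b \<phi>" "a < b" "integral {a..b} \<phi> = m * (b - a)"
  shows "integral {a..b} (\<lambda>t. exp_tangent_gap (m - x) (\<phi> t)) \<le> C * x\<^sup>2 * exp m * (b - a)"
proof -
  have "C * exp m - exp (m - x) * (1 + m - (m - x)) = C * x\<^sup>2 * exp m"
    by (simp add: exp_diff_x algebra_simps power2_eq_square)
  then show ?thesis using integral_exp_tangent_gap_le[OF assms, of "m - x"] by simp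
qed

text \<open>The quotient of the integrals of the gaps at \<open>m - x\<close> and \<open>m - \<delta> - x\<close> in the extreme case
  where the mean of \<open>e\<^sup>\<phi>\<close> is \<open>C e\<^sup>m\<close>.\<close>

definition gap_ratio :: "real \<Rightarrow> real" where
  "gap_ratio \<delta> = x\<^sup>2 / (1 - (1 - x) * (1 + x + \<delta>) * exp (- \<delta>))"

lemma gap_ratio_bounds:
  assumes "0 \<le> \<delta>"
  shows "0 < gap_ratio \<delta>" "gap_ratio \<delta> \<le> 1"
proof -
  have "1 + x + \<delta> \<le> (1 + x) * (1 + \<delta>)"
    using x_pos assms by (simp add: algebra_simps)
  also have "\<dots> \<le> (1 + x) * exp \<delta>"
    using x_pos by (intro mult_left_mono exp_ge_add_one_self) auto
  finally have "(1 + x + \<delta>) * exp (- \<delta>) \<le> 1 + x"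
    by (simp add: exp_minus divide_le_eq flip: divide_inverse)
  then have "(1 - x) * ((1 + x + \<delta>) * exp (- \<delta>)) \<le> (1 - x) * (1 + x)"
    using x_less_1 by (intro mult_left_mono) auto
  then have denominator: "x\<^sup>2 \<le> 1 - (1 - x) * (1 + x + \<delta>) * exp (- \<delta>)"
    by (simp add: algebra_simps power2_eq_square)
  have "0 < x\<^sup>2" using x_pos by simp
  with denominator show "0 < gap_ratio \<delta>"
    unfolding gap_ratio_def by (intro divide_pos_pos) linarith+
  show "gap_ratio \<delta> \<le> 1"
    unfolding gap_ratio_def using denominator \<open>0 < x\<^sup>2\<close> by (subst divide_le_eq_1_pos) linarith+
qed

lemma gap_ratio_power_limit: "(\<lambda>n. gap_ratio (L / real n) ^ n) \<longlonglongrightarrow> exp (L * (1 - 1 / x))"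
proof (rule power_tendsto_exp_of_derivative)
  define D where "D \<delta> = 1 - (1 - x) * (1 + x + \<delta>) * exp (- \<delta>)" for \<delta>
  have D_0: "D 0 = x\<^sup>2" by (simp add: D_def power2_eq_square algebra_simps)
  show "gap_ratio 0 = 1"
    using x_pos D_0 by (simp add: gap_ratio_def D_def)
  have "(D has_real_derivative (1 - x) * x) (at 0)"
    unfolding D_def by (auto intro!: derivative_eq_intros simp: algebra_simps)
  then have "((\<lambda>\<delta>. x\<^sup>2 / D \<delta>) has_real_derivative - ((1 - x) * x * x\<^sup>2) / (x\<^sup>2 * x\<^sup>2)) (at 0)"
    using D_0 x_pos by (auto intro!: derivative_eq_intros)
  moreover have "- ((1 - x) * x * x\<^sup>2) / (x\<^sup>2 * x\<^sup>2) = 1 - 1 / x"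
    using x_pos by (simp add: field_simps power2_eq_square)
  ultimately show "(gap_ratio has_real_derivative 1 - 1 / x) (at 0)"
    by (simp add: gap_ratio_def[abs_def] D_def)
qed

lemma integral_gap_le_gap_ratio:
  assumes \<phi>: "log_A_inf_on C a b \<phi>" "a < b" "integral {a..b} \<phi> = m * (b - a)" and "0 \<le> \<delta>"
  shows "integral {a..b} (\<lambda>t. exp_tangent_gap (m - x) (\<phi> t))
    \<le> gap_ratio \<delta> * integral {a..b} (\<lambda>t. exp_tangent_gap (m - \<delta> - x) (\<phi> t))"
proof -
  define X where "X = integral {a..b} (\<lambda>t. exp (\<phi> t))"
  define T where "T = C * (b - a) * exp m"
  define q where "q = (1 - x) * (1 + x + \<delta>) * exp (- \<delta>)"
  have "exp (m - x) * (1 + m - (m - x)) * (b - a) = (1 - x\<^sup>2) * T"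
    by (simp add: exp_diff_x T_def power2_eq_square algebra_simps)
  then have gap_at_m: "integral {a..b} (\<lambda>t. exp_tangent_gap (m - x) (\<phi> t)) = X - (1 - x\<^sup>2) * T"
    by (simp add: integral_exp_tangent_gap[OF \<phi>] X_def)
  have "exp (m - \<delta> - x) = C * (1 - x) * exp m * exp (- \<delta>)"
    unfolding exp_diff_x by (simp flip: exp_add)
  moreover have "1 + m - (m - \<delta> - x) = 1 + x + \<delta>" by simp
  ultimately have "exp (m - \<delta> - x) * (1 + m - (m - \<delta> - x)) * (b - a) = q * T"
    by (simp only: T_def q_def mult_ac)
  then have gap_below_m: "integral {a..b} (\<lambda>t. exp_tangent_gap (m - \<delta> - x) (\<phi> t)) = X - q * T"
    by (simp add: integral_exp_tangent_gap[OF \<phi>] X_def)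
  have "X \<le> T"
    using log_A_inf_on_mean[OF \<phi>] by (simp add: X_def T_def)
  then have "(1 - gap_ratio \<delta>) * X \<le> (1 - gap_ratio \<delta>) * T"
    using gap_ratio_bounds(2)[OF \<open>0 \<le> \<delta>\<close>] by (intro mult_left_mono) auto
  moreover have "gap_ratio \<delta> * (1 - q) = x\<^sup>2"
    using gap_ratio_bounds(1)[OF \<open>0 \<le> \<delta>\<close>] by (auto simp: gap_ratio_def q_def)
  then have "gap_ratio \<delta> * ((1 - q) * T) = x\<^sup>2 * T" by simp
  ultimately show ?thesis
    unfolding gap_at_m gap_below_m by (simp add: algebra_simps)
qed

lemma superlevel_measure_gap_bound_descend:
  assumes \<phi>: "log_A_inf_on C a b \<phi>" "a < b" "integral {a..b} \<phi> = (\<mu> - \<delta>) * (b - a)"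
    and "0 \<le> \<delta>" "\<mu> < s" "0 \<le> k"
    and block: "\<And>c d. \<lbrakk>log_A_inf_on C c d \<phi>; c < d; integral {c..d} \<phi> = \<mu> * (d - c)\<rbrakk>
      \<Longrightarrow> superlevel_measure c d \<phi> s \<le> k * integral {c..d} (\<lambda>t. exp_tangent_gap (\<mu> - x) (\<phi> t))"
  shows "superlevel_measure a b \<phi> s
    \<le> k * gap_ratio \<delta> * integral {a..b} (\<lambda>t. exp_tangent_gap (\<mu> - \<delta> - x) (\<phi> t))"
proof -
  let ?g = "\<lambda>t. k * gap_ratio \<delta> * exp_tangent_gap (\<mu> - \<delta> - x) (\<phi> t)"
  have "superlevel_measure a b \<phi> s \<le> integral {a..b} ?g"
  proof (rule superlevel_measure_le_of_mean_blocks[where \<kappa> = 1, OF less_imp_le[OF \<phi>(2)]])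
    show "\<phi> absolutely_integrable_on {a..b}" by (rule log_A_inf_onD(1)[OF \<phi>(1)])
    show "?g absolutely_integrable_on {a..b}"
      using absolutely_integrable_exp_tangent_gap[OF \<phi>(1)]
      by (intro set_integrable_mult_right) auto
    show "1 * (integral {a..b} \<phi> - \<mu> * (b - a)) \<le> 0"
      using \<phi>(2,3) \<open>0 \<le> \<delta>\<close> by (simp add: mult_right_mono)
    show "of_bool (s \<le> \<phi> t) \<le> ?g t" if "1 * (\<phi> t - \<mu>) \<le> 0" for t
      using that \<open>\<mu> < s\<close> \<open>0 \<le> k\<close> gap_ratio_bounds(1)[OF \<open>0 \<le> \<delta>\<close>] exp_tangent_gap_nonneg by simp
    fix c d assume sub: "a \<le> c" "c < d" "d \<le> b" and mean: "integral {c..d} \<phi> = \<mu> * (d - c)"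
    note \<phi>_sub = log_A_inf_on_subinterval[OF \<phi>(1) sub(1,3)]
    have "superlevel_measure c d \<phi> s \<le> k * integral {c..d} (\<lambda>t. exp_tangent_gap (\<mu> - x) (\<phi> t))"
      by (rule block[OF \<phi>_sub sub(2) mean])
    also have "\<dots> \<le> k * (gap_ratio \<delta> * integral {c..d} (\<lambda>t. exp_tangent_gap (\<mu> - \<delta> - x) (\<phi> t)))"
      using integral_gap_le_gap_ratio[OF \<phi>_sub sub(2) mean \<open>0 \<le> \<delta>\<close>] \<open>0 \<le> k\<close>
      by (rule mult_left_mono)
    finally show "superlevel_measure c d \<phi> s \<le> integral {c..d} ?g"
      by simp
  qed simp
  then show ?thesis by simp
qed

lemma superlevel_measure_le_gap_ratio_power:
  assumes \<phi>: "log_A_inf_on C a b \<phi>" "a < b" "integral {a..b} \<phi> = (M - real n * \<delta>) * (b - a)"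
    and "0 \<le> \<delta>"
  shows "superlevel_measure a b \<phi> (M + y)
    \<le> gap_ratio \<delta> ^ n / exp_tangent_gap (M - x) (M + y)
      * integral {a..b} (\<lambda>t. exp_tangent_gap (M - real n * \<delta> - x) (\<phi> t))"
  using \<phi>
proof (induction n arbitrary: a b)
  case 0
  then show ?case
    using superlevel_measure_le_integral_gap[of C a b \<phi> "M - x" "M + y"] x_pos y_pos by simp
next
  case (Suc n)
  have level: "M - real (Suc n) * \<delta> = M - real n * \<delta> - \<delta>" by (simp add: algebra_simps)
  have "superlevel_measure a b \<phi> (M + y)
      \<le> gap_ratio \<delta> ^ n / exp_tangent_gap (M - x) (M + y) * gap_ratio \<delta>
        * integral {a..b} (\<lambda>t. exp_tangent_gap (M - real n * \<delta> - \<delta> - x) (\<phi> t))"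
  proof (rule superlevel_measure_gap_bound_descend[OF Suc.prems(1,2) _ \<open>0 \<le> \<delta>\<close> _ _ Suc.IH])
    show "integral {a..b} \<phi> = (M - real n * \<delta> - \<delta>) * (b - a)"
      using Suc.prems(3) unfolding level .
    show "M - real n * \<delta> < M + y"
      using mult_nonneg_nonneg[of "real n" \<delta>] \<open>0 \<le> \<delta>\<close> y_pos by linarith
    show "0 \<le> gap_ratio \<delta> ^ n / exp_tangent_gap (M - x) (M + y)"
      using gap_ratio_bounds(1)[OF \<open>0 \<le> \<delta>\<close>] exp_tangent_gap_nonneg by simp
  qed
  then show ?case unfolding level by (simp add: mult_ac)
qed

lemma exponential_tail:
  assumes \<phi>: "log_A_inf_on C a b \<phi>" "a < b" "integral {a..b} \<phi> = m * (b - a)" and "0 \<le> L"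
  shows "superlevel_measure a b \<phi> (m + L + y) \<le> x / (x + y) * exp (- L / x) * (b - a)"
    (is "?N \<le> _")
proof -
  let ?K = "x / (x + y) * exp (- L) * (b - a)"
  have K_eq: "C * x\<^sup>2 * exp m * (b - a) / exp_tangent_gap (m + L - x) (m + L + y) = ?K"
    unfolding exp_tangent_gap_across using C_pos x_pos y_pos
    by (simp add: exp_add exp_minus power2_eq_square divide_simps)
  have subdivided: "?N \<le> gap_ratio (L / real n) ^ n * ?K" if "0 < n" for n
  proof -
    have ratio_nonneg: "0 \<le> gap_ratio (L / real n) ^ n / exp_tangent_gap (m + L - x) (m + L + y)"
      using gap_ratio_bounds(1)[of "L / real n"] exp_tangent_gap_nonneg \<open>0 \<le> L\<close> by simp
    have level: "m + L - real n * (L / real n) = m" using that by simp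
    have "?N \<le> gap_ratio (L / real n) ^ n / exp_tangent_gap (m + L - x) (m + L + y)
        * integral {a..b} (\<lambda>t. exp_tangent_gap (m - x) (\<phi> t))"
      by (rule superlevel_measure_le_gap_ratio_power[OF \<phi>(1,2), of "m + L" n "L / real n",
            unfolded level]) (use \<phi>(3) \<open>0 \<le> L\<close> in simp_all)
    also have "\<dots> \<le> gap_ratio (L / real n) ^ n / exp_tangent_gap (m + L - x) (m + L + y)
        * (C * x\<^sup>2 * exp m * (b - a))"
      using ratio_nonneg by (intro mult_left_mono integral_gap_at_mean_le[OF \<phi>])
    also have "\<dots> = gap_ratio (L / real n) ^ n * ?K"
      unfolding K_eq[symmetric] by simp
    finally show ?thesis .
  qed
  have "?N \<le> exp (L * (1 - 1 / x)) * ?K"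
  proof (rule tendsto_lowerbound)
    show "(\<lambda>n. gap_ratio (L / real n) ^ n * ?K) \<longlonglongrightarrow> exp (L * (1 - 1 / x)) * ?K"
      by (intro tendsto_mult_right gap_ratio_power_limit)
    show "\<forall>\<^sub>F n in sequentially. ?N \<le> gap_ratio (L / real n) ^ n * ?K"
      using eventually_gt_at_top[of 0] by eventually_elim (rule subdivided)
  qed simp
  also have "\<dots> = x / (x + y) * exp (L * (1 - 1 / x) + - L) * (b - a)"
    unfolding exp_add by simp
  also have "L * (1 - 1 / x) + - L = - L / x"
    by (simp add: algebra_simps)
  finally show ?thesis .
qed

lemma linear_tail:
  assumes \<phi>: "log_A_inf_on C a b \<phi>" "a < b" "integral {a..b} \<phi> = m * (b - a)" and "lam \<le> y"
  shows "superlevel_measure a b \<phi> (m + lam) \<le> (1 - lam / (x + y)) * (b - a)"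
proof -
  define u where "u = m + lam - y"
  let ?g = "\<lambda>t. (\<phi> t - (u - x)) / (x + y)"
  have integral_g: "integral {c..d} ?g = (integral {c..d} \<phi> - (u - x) * (d - c)) / (x + y)"
    if "a \<le> c" "c < d" "d \<le> b" for c d
  proof -
    have "\<phi> integrable_on {c..d}"
      using log_A_inf_onD(2)[OF log_A_inf_on_subinterval[OF \<phi>(1)]] that by simp
    then show ?thesis using that by (simp add: integral_diff_const)
  qed
  have "superlevel_measure a b \<phi> (u + y) \<le> integral {a..b} ?g"
  proof (rule superlevel_measure_le_of_mean_blocks[where \<kappa> = "- 1", OF less_imp_le[OF \<phi>(2)]])
    show integrable: "\<phi> absolutely_integrable_on {a..b}" by (rule log_A_inf_onD(1)[OF \<phi>(1)])
    then show "?g absolutely_integrable_on {a..b}"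
      by (intro set_integral_diff set_integrable_divide absolutely_integrable_on_const) auto
    show "- 1 * (integral {a..b} \<phi> - u * (b - a)) \<le> 0"
      using \<phi>(2,3) \<open>lam \<le> y\<close> by (simp add: u_def mult_right_mono)
    show "of_bool (u + y \<le> \<phi> t) \<le> ?g t" if "- 1 * (\<phi> t - u) \<le> 0" for t
      using that x_pos y_pos by (auto simp: of_bool_def)
    fix c d assume sub: "a \<le> c" "c < d" "d \<le> b" and mean: "integral {c..d} \<phi> = u * (d - c)"
    have "superlevel_measure c d \<phi> (u + y) \<le> x / (x + y) * (d - c)"
      using exponential_tail[OF log_A_inf_on_subinterval[OF \<phi>(1) sub(1,3)] sub(2) mean, of 0]
      by simp
    also have "\<dots> = integral {c..d} ?g"
      unfolding integral_g[OF sub] mean by (simp add: algebra_simps)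
    finally show "superlevel_measure c d \<phi> (u + y) \<le> integral {c..d} ?g" .
  qed simp
  also have "integral {a..b} ?g = (1 - lam / (x + y)) * (b - a)"
    using integral_g[of a b] \<phi>(2,3) x_pos y_pos by (simp add: u_def field_simps)
  finally show ?thesis by (simp add: u_def)
qed

definition tail :: "real \<Rightarrow> real" where
  "tail lam =
     (if lam \<le> y then 1 - lam / (x + y) else x * exp (y / x) / (x + y) * exp (- lam / x))"

lemma superlevel_measure_le_tail:
  assumes "log_A_inf_on C a b \<phi>" "a < b" "integral {a..b} \<phi> = m * (b - a)"
  shows "superlevel_measure a b \<phi> (m + lam) \<le> tail lam * (b - a)"
proof (cases "lam \<le> y")
  case True
  then show ?thesis using linear_tail[OF assms] by (simp add: tail_def)
next
  case False
  then have "superlevel_measure a b \<phi> (m + (lam - y) + y)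
      \<le> x / (x + y) * exp (- (lam - y) / x) * (b - a)"
    by (intro exponential_tail[OF assms]) simp
  also have "exp (- (lam - y) / x) = exp (y / x) * exp (- lam / x)"
    by (simp add: diff_divide_distrib flip: exp_add)
  also have "m + (lam - y) + y = m + lam" by simp
  finally show ?thesis using False by (simp add: tail_def)
qed

end

section \<open>Intervals and their endpoints\<close>

definition interval_ends :: "real set \<Rightarrow> real \<Rightarrow> real \<Rightarrow> bool" where
  "interval_ends J a b \<longleftrightarrow> a < b \<and> {a<..<b} \<subseteq> J \<and> J \<subseteq> {a..b}"

lemma interval_ends_less: "interval_ends J a b \<Longrightarrow> a < b"
  by (simp add: interval_ends_def)

lemma interval_ends_greaterThanLessThan: "a < b \<Longrightarrow> interval_ends {a<..<b} a b"
  by (auto simp: interval_ends_def)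

lemma subintervals_ends:
  assumes "J \<in> subintervals Q"
  obtains a b where "interval_ends J a b" "{a<..<b} \<subseteq> Q"
proof -
  have J: "nondegenerate_interval J" "bounded J" "J \<subseteq> Q"
    using assms by (auto simp: subintervals_def)
  obtain a b where ends: "a < b" "interior J = {a<..<b}" "closure J = {a..b}"
    using nondegenerate_interval_closure_interior[OF J(1,2)] .
  then have "{a<..<b} \<subseteq> J" "J \<subseteq> {a..b}"
    using interior_subset[of J] closure_subset[of J] by auto
  then show ?thesis using that ends(1) J(3) by (auto simp: interval_ends_def)
qed

lemma greaterThanLessThan_in_subintervals:
  assumes "c < d" "{c<..<d} \<subseteq> Q"
  shows "{c<..<d} \<in> subintervals Q"
  using assms
  by (simp add: subintervals_def nondegenerate_interval_def is_interval_oo interior_open)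

lemma interval_ends_symmetric_difference:
  assumes "interval_ends J a b"
  shows "J - {a..b} \<union> ({a..b} - J) \<subseteq> {a, b}"
  using assms by (auto simp: interval_ends_def subset_iff) (metis less_eq_real_def)

lemma negligible_interval_ends:
  assumes "interval_ends J a b"
  shows "negligible ({a..b} - J \<union> (J - {a..b}))"
  by (rule negligible_subset[of "{a, b}"])
    (use interval_ends_symmetric_difference[OF assms] in auto)

lemma measure_interval_ends:
  assumes "interval_ends J a b"
  shows "measure lebesgue J = b - a"
  using measure_negligible_symdiff[OF _ negligible_interval_ends[OF assms]]
    interval_ends_less[OF assms] by simp

lemma measure_Collect_interval_ends:
  assumes J: "interval_ends J a b" and P: "{t \<in> {a..b}. P t} \<in> lmeasurable"
  shows "measure lebesgue {t \<in> J. P t} = measure lebesgue {t \<in> {a..b}. P t}"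
  by (rule measure_negligible_symdiff[OF P negligible_subset[OF negligible_interval_ends[OF J]]])
    auto

lemma set_integrable_interval_ends_iff:
  fixes f :: "real \<Rightarrow> real"
  assumes "interval_ends J a b"
  shows "set_integrable lebesgue J f \<longleftrightarrow> f absolutely_integrable_on {a..b}"
  by (rule set_integrable_discrete_difference[OF _ interval_ends_symmetric_difference[OF assms]])
    auto

lemma average_interval_ends:
  assumes J: "interval_ends J a b" and f: "f absolutely_integrable_on {a..b}"
  shows "average J f = integral {a..b} f / (b - a)"
proof -
  have "(LINT t:J|lebesgue. f t) = (LINT t:{a..b}|lebesgue. f t)"
    by (rule set_integral_discrete_difference[OF _ interval_ends_symmetric_difference[OF J]]) auto
  then show ?thesis
    by (simp add: average_def measure_interval_ends[OF J]
        set_lebesgue_integral_eq_integral(2)[OF f])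
qed

lemma exp_in_A_inf_le_iff_average:
  "(\<lambda>t. exp (\<phi> t)) \<in> A_inf_le C Q \<longleftrightarrow>
    (\<forall>J\<in>subintervals Q. set_integrable lebesgue J \<phi> \<and> set_integrable lebesgue J (\<lambda>t. exp (\<phi> t))
      \<and> average J (\<lambda>t. exp (\<phi> t)) \<le> C * exp (average J \<phi>))"
proof -
  have "A_inf_char Q (\<lambda>t. exp (\<phi> t)) \<le> ereal C \<Longrightarrow> A_inf_char Q (\<lambda>t. exp (\<phi> t)) < \<infinity>"
    by (rule le_less_trans) auto
  moreover have "p * exp (- q) \<le> C \<longleftrightarrow> p \<le> C * exp q" for p q :: real
    by (simp add: exp_minus field_simps)
  ultimately show ?thesis
    by (auto simp: A_inf_le_def A_inf_def A_inf_char_def SUP_le_iff)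
qed

lemma average_exp_le_iff:
  assumes J: "interval_ends J a b"
    and \<phi>: "\<phi> absolutely_integrable_on {a..b}" "(\<lambda>t. exp (\<phi> t)) absolutely_integrable_on {a..b}"
  shows "average J (\<lambda>t. exp (\<phi> t)) \<le> C * exp (average J \<phi>) \<longleftrightarrow>
    integral {a..b} (\<lambda>t. exp (\<phi> t)) \<le> C * (b - a) * exp (integral {a..b} \<phi> / (b - a))"
  using interval_ends_less[OF J]
  by (simp add: average_interval_ends[OF J \<phi>(1)] average_interval_ends[OF J \<phi>(2)]
      pos_divide_le_eq mult_ac)

lemma log_A_inf_on_if_exp_in_A_inf_le:
  assumes weight: "(\<lambda>t. exp (\<phi> t)) \<in> A_inf_le C Q" and "a < b" "{a<..<b} \<subseteq> Q"
  shows "log_A_inf_on C a b \<phi>"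
proof -
  have condition: "\<phi> absolutely_integrable_on {c..d}
      \<and> (\<lambda>t. exp (\<phi> t)) absolutely_integrable_on {c..d}
      \<and> average {c<..<d} (\<lambda>t. exp (\<phi> t)) \<le> C * exp (average {c<..<d} \<phi>)"
    if "a \<le> c" "c < d" "d \<le> b" for c d
  proof -
    have "{c<..<d} \<in> subintervals Q"
      using \<open>{a<..<b} \<subseteq> Q\<close> that by (intro greaterThanLessThan_in_subintervals) force+
    moreover have "interval_ends {c<..<d} c d"
      using that(2) by (rule interval_ends_greaterThanLessThan)
    ultimately show ?thesis
      using weight set_integrable_interval_ends_iff
      unfolding exp_in_A_inf_le_iff_average by blast
  qed
  show ?thesis
    unfolding log_A_inf_on_def
    using condition[OF order_refl \<open>a < b\<close> order_refl] condition
      average_exp_le_iff[OF interval_ends_greaterThanLessThan] by blast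
qed

lemma exp_in_A_inf_leI:
  assumes log: "\<And>a b. \<lbrakk>a < b; {a<..<b} \<subseteq> Q\<rbrakk> \<Longrightarrow> log_A_inf_on C a b \<phi>"
  shows "(\<lambda>t. exp (\<phi> t)) \<in> A_inf_le C Q"
  unfolding exp_in_A_inf_le_iff_average
proof
  fix J assume "J \<in> subintervals Q"
  then obtain a b where ends: "interval_ends J a b" and "{a<..<b} \<subseteq> Q"
    by (rule subintervals_ends)
  then have "log_A_inf_on C a b \<phi>"
    using log interval_ends_less by blast
  then show "set_integrable lebesgue J \<phi> \<and> set_integrable lebesgue J (\<lambda>t. exp (\<phi> t))
      \<and> average J (\<lambda>t. exp (\<phi> t)) \<le> C * exp (average J \<phi>)"
    using average_exp_le_iff[OF ends] interval_ends_less[OF ends]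
    by (simp add: log_A_inf_on_def set_integrable_interval_ends_iff[OF ends])
qed

definition tail_fraction :: "real set \<Rightarrow> (real \<Rightarrow> real) \<Rightarrow> real \<Rightarrow> real" where
  "tail_fraction J \<phi> lam = measure lebesgue {t \<in> J. \<phi> t - average J \<phi> \<ge> lam} / measure lebesgue J"

lemma tail_fraction_interval_ends:
  assumes J: "interval_ends J a b"
    and \<phi>: "\<phi> absolutely_integrable_on {a..b}" "integral {a..b} \<phi> = m * (b - a)"
  shows "tail_fraction J \<phi> lam = superlevel_measure a b \<phi> (m + lam) / (b - a)"
proof -
  have "average J \<phi> = m"
    using average_interval_ends[OF J \<phi>(1)] \<phi>(2) interval_ends_less[OF J] by simp
  then have "{t \<in> J. \<phi> t - average J \<phi> \<ge> lam} = {t \<in> J. m + lam \<le> \<phi> t}" by auto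
  moreover have "{t \<in> {a..b}. m + lam \<le> \<phi> t} \<in> lmeasurable"
    using \<phi>(1) by (rule superlevel_lmeasurable) simp
  ultimately show ?thesis
    by (simp only: tail_fraction_def superlevel_measure_def measure_interval_ends[OF J]
        measure_Collect_interval_ends[OF J])
qed

lemma tail_fraction_const:
  assumes "J \<in> subintervals Q"
  shows "tail_fraction J (\<lambda>_. k) lam = of_bool (lam \<le> 0)"
proof -
  obtain a b where ends: "interval_ends J a b"
    using subintervals_ends[OF assms] .
  then show ?thesis
    using tail_fraction_interval_ends[OF ends, of "\<lambda>_. k" k lam] interval_ends_less[OF ends]
    by (simp add: superlevel_measure_const)
qed

lemma exp_const_in_A_inf_le:
  assumes "1 \<le> C"
  shows "(\<lambda>_. exp k) \<in> A_inf_le C Q"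
proof (rule exp_in_A_inf_leI)
  have const: "(\<lambda>_. p :: real) absolutely_integrable_on {a..b}" for p a b :: real
    by (rule absolutely_integrable_on_const) auto
  show "log_A_inf_on C a b (\<lambda>_. k)" for a b
    using assms const by (simp add: log_A_inf_on_def)
qed

section \<open>The extremal function\<close>

context tangent_pair
begin

definition jump :: real where
  "jump = x / (x + y)"

text \<open>The mean over \<open>(0, s)\<close> decreases from \<open>y\<close> to \<open>0\<close> along the chord tangent to the upper
  boundary of the domain \<open>e\<^sup>p \<le> q \<le> C e\<^sup>p\<close> of means, and for \<open>s \<ge> 1\<close> it follows that boundary.\<close>

definition extremal :: "real \<Rightarrow> real" where
  "extremal t = (if t \<le> jump then y else if t \<le> 1 then - x else - x * (1 + ln t))"

definition extremal_primitive :: "real \<Rightarrow> real" where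
  "extremal_primitive t =
     (if t \<le> jump then y * t else if t \<le> 1 then x - x * t else - x * ln t * t)"

definition exp_extremal_primitive :: "real \<Rightarrow> real" where
  "exp_extremal_primitive t =
     (if t \<le> 1 then C * (t + extremal_primitive t) else C * exp (- x * ln t) * t)"

lemma jump_bounds: "0 < jump" "jump < 1"
  using x_pos y_pos by (auto simp: jump_def)

lemma jump_balance: "y * jump = x - x * jump"
  using x_pos y_pos by (auto simp: jump_def field_simps)

lemma continuous_extremal_primitive: "continuous_on {0..} extremal_primitive"
  unfolding extremal_primitive_def
proof (rule continuous_on_cases_le[where h = "\<lambda>t. t"])
  show "continuous_on {t \<in> {0..}. jump \<le> t} (\<lambda>t. if t \<le> 1 then x - x * t else - x * ln t * t)"
    using jump_bounds by (intro continuous_on_cases_le[where h = "\<lambda>t. t"] continuous_intros) auto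
qed (use jump_bounds jump_balance in \<open>auto intro!: continuous_intros\<close>)

lemma continuous_exp_extremal_primitive: "continuous_on {0..} exp_extremal_primitive"
  unfolding exp_extremal_primitive_def
proof (rule continuous_on_cases_le[where h = "\<lambda>t. t"])
  show "continuous_on {t \<in> {0..}. t \<le> 1} (\<lambda>t. C * (t + extremal_primitive t))"
    by (intro continuous_intros continuous_on_subset[OF continuous_extremal_primitive]) auto
  show "continuous_on {t \<in> {0..}. 1 \<le> t} (\<lambda>t. C * exp (- x * ln t) * t)"
    by (intro continuous_intros) auto
qed (use jump_bounds in \<open>auto intro!: continuous_intros simp: extremal_primitive_def\<close>)

lemma extremal_primitive_has_real_derivative:
  assumes t: "0 < t" "t \<noteq> jump" "t \<noteq> 1"
  shows "(extremal_primitive has_real_derivative extremal t) (at t)"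
proof -
  consider (high) "t < jump" | (low) "jump < t" "t < 1" | (logarithmic) "1 < t"
    using t by linarith
  then show ?thesis
  proof cases
    case high
    have "((\<lambda>t. y * t) has_real_derivative extremal t) (at t)"
      using high by (auto intro!: derivative_eq_intros simp: extremal_def)
    then show ?thesis
      by (rule has_field_derivative_transform_within_open[of _ _ _ "{..<jump}"])
        (use high in \<open>auto simp: extremal_primitive_def\<close>)
  next
    case low
    have "((\<lambda>t. x - x * t) has_real_derivative extremal t) (at t)"
      using low by (auto intro!: derivative_eq_intros simp: extremal_def)
    then show ?thesis
      by (rule has_field_derivative_transform_within_open[of _ _ _ "{jump<..<1}"])
        (use low in \<open>auto simp: extremal_primitive_def\<close>)
  next
    case logarithmic
    have "((\<lambda>t. - x * ln t * t) has_real_derivative extremal t) (at t)"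
      using logarithmic jump_bounds
      by (auto intro!: derivative_eq_intros simp: extremal_def algebra_simps)
    then show ?thesis
      by (rule has_field_derivative_transform_within_open[of _ _ _ "{1<..}"])
        (use logarithmic jump_bounds in \<open>auto simp: extremal_primitive_def\<close>)
  qed
qed

lemma exp_extremal:
  shows "t \<le> 1 \<Longrightarrow> exp (extremal t) = C * (1 + extremal t)"
    and "1 < t \<Longrightarrow> exp (extremal t) = C * (1 - x) * exp (- x * ln t)"
proof -
  show "exp (extremal t) = C * (1 + extremal t)" if "t \<le> 1"
    using that exp_x exp_y by (simp add: extremal_def)
  show "exp (extremal t) = C * (1 - x) * exp (- x * ln t)" if "1 < t"
  proof -
    have "extremal t = - x * ln t - x"
      using that jump_bounds by (simp add: extremal_def algebra_simps)
    then show ?thesis by (simp only: exp_diff_x)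
  qed
qed

lemma exp_extremal_primitive_has_real_derivative:
  assumes t: "0 < t" "t \<noteq> jump" "t \<noteq> 1"
  shows "(exp_extremal_primitive has_real_derivative exp (extremal t)) (at t)"
proof (cases "t < 1")
  case True
  have "((\<lambda>t. C * (t + extremal_primitive t)) has_real_derivative exp (extremal t)) (at t)"
    using True exp_extremal(1)
    by (auto intro!: derivative_eq_intros extremal_primitive_has_real_derivative[OF t])
  then show ?thesis
    by (rule has_field_derivative_transform_within_open[of _ _ _ "{..<1}"])
      (use True in \<open>auto simp: exp_extremal_primitive_def\<close>)
next
  case False
  then have "1 < t" using t by simp
  then have "((\<lambda>t. C * exp (- x * ln t) * t) has_real_derivative exp (extremal t)) (at t)"
    using exp_extremal(2) by (auto intro!: derivative_eq_intros simp: algebra_simps)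
  then show ?thesis
    by (rule has_field_derivative_transform_within_open[of _ _ _ "{1<..}"])
      (use \<open>1 < t\<close> in \<open>auto simp: exp_extremal_primitive_def\<close>)
qed

lemma extremal_has_integral:
  assumes "0 \<le> c" "c \<le> d"
  shows "(extremal has_integral extremal_primitive d - extremal_primitive c) {c..d}"
  by (rule fundamental_theorem_of_calculus_interior_strong[of "{jump, 1}"])
    (use assms in \<open>auto intro!: extremal_primitive_has_real_derivative
      continuous_on_subset[OF continuous_extremal_primitive]
      simp flip: has_real_derivative_iff_has_vector_derivative\<close>)

lemma exp_extremal_has_integral:
  assumes "0 \<le> c" "c \<le> d"
  shows "((\<lambda>t. exp (extremal t)) has_integral
    exp_extremal_primitive d - exp_extremal_primitive c) {c..d}"
  by (rule fundamental_theorem_of_calculus_interior_strong[of "{jump, 1}"])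
    (use assms in \<open>auto intro!: exp_extremal_primitive_has_real_derivative
      continuous_on_subset[OF continuous_exp_extremal_primitive]
      simp flip: has_real_derivative_iff_has_vector_derivative\<close>)

lemma extremal_neg:
  assumes "jump < t"
  shows "extremal t < 0"
proof (cases "t \<le> 1")
  case False
  then have "0 < x * (1 + ln t)" using x_pos by (intro mult_pos_pos add_pos_pos) auto
  then show ?thesis using False assms by (simp add: extremal_def)
qed (use assms x_pos in \<open>simp add: extremal_def\<close>)

lemma extremal_le_y: "extremal t \<le> y"
  using extremal_neg[of t] y_pos by (cases "t \<le> jump") (auto simp: extremal_def)

lemma extremal_absolutely_integrable:
  assumes "0 \<le> c" "c \<le> d"
  shows "extremal absolutely_integrable_on {c..d}"
proof -
  have "(\<lambda>t. y) absolutely_integrable_on {c..d}" by (rule absolutely_integrable_on_const) auto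
  then show ?thesis
    using extremal_has_integral[OF assms] extremal_le_y
    by (intro absolutely_integrable_absolutely_integrable_ubound[of extremal "{c..d}" "\<lambda>_. y"]) auto
qed

lemma exp_extremal_absolutely_integrable:
  assumes "0 \<le> c" "c \<le> d"
  shows "(\<lambda>t. exp (extremal t)) absolutely_integrable_on {c..d}"
  using exp_extremal_has_integral[OF assms] by (intro nonnegative_absolutely_integrable_1) auto

lemma exp_extremal_primitive_ge_tangent:
  assumes "0 \<le> t" "v \<le> 0"
  shows "C * exp v * ((1 - v) * t + extremal_primitive t) \<le> exp_extremal_primitive t"
proof (cases "t \<le> 1")
  case True
  have "exp v * (1 - v) * t \<le> 1 * t"
    using exp_tangent_le[of v 0] assms(1) by (intro mult_right_mono) auto
  moreover have "0 \<le> extremal_primitive t"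
    using True assms(1) x_pos y_pos by (auto simp: extremal_primitive_def mult_left_le)
  then have "exp v * extremal_primitive t \<le> 1 * extremal_primitive t"
    using assms(2) by (intro mult_right_mono) auto
  ultimately have "C * (exp v * (1 - v) * t + exp v * extremal_primitive t)
      \<le> C * (t + extremal_primitive t)"
    using C_pos by (intro mult_left_mono) auto
  then show ?thesis using True by (simp add: exp_extremal_primitive_def algebra_simps)
next
  case False
  have "C * t * (exp v * (1 + (- x * ln t) - v)) \<le> C * t * exp (- x * ln t)"
    using C_pos assms(1) by (intro mult_left_mono exp_tangent_le) auto
  then show ?thesis
    using False jump_bounds
    by (simp add: extremal_primitive_def exp_extremal_primitive_def algebra_simps)
qed

lemma exp_extremal_primitive_eq_tangent:
  assumes "v = (if t \<le> 1 then 0 else - x * ln t)"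
  shows "exp_extremal_primitive t = C * exp v * ((1 - v) * t + extremal_primitive t)"
  using assms jump_bounds
  by (auto simp: exp_extremal_primitive_def extremal_primitive_def algebra_simps)

lemma exp_extremal_primitive_diff_le:
  assumes "0 \<le> c" "c < d"
  shows "exp_extremal_primitive d - exp_extremal_primitive c
    \<le> C * (d - c) * exp ((extremal_primitive d - extremal_primitive c) / (d - c))"
proof -
  \<comment> \<open>The means over \<open>(0, d)\<close> lie on the tangent to the upper boundary at \<open>v\<close>, those over
    \<open>(0, c)\<close> on or above it; hence the means over \<open>(c, d)\<close> lie on or below it.\<close>
  define v where "v = (if d \<le> 1 then 0 else - x * ln d)"
  define m where "m = (extremal_primitive d - extremal_primitive c) / (d - c)"
  have diff_eq: "extremal_primitive d - extremal_primitive c = m * (d - c)"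
    using assms by (simp add: m_def)
  have "v \<le> 0" using x_pos by (auto simp: v_def)
  then have "exp_extremal_primitive d - exp_extremal_primitive c
      \<le> C * exp v * ((1 - v) * d + extremal_primitive d)
        - C * exp v * ((1 - v) * c + extremal_primitive c)"
    using exp_extremal_primitive_eq_tangent[OF v_def]
      exp_extremal_primitive_ge_tangent[OF assms(1)] by simp
  also have "\<dots> = C * exp v * ((1 - v) * (d - c) + (extremal_primitive d - extremal_primitive c))"
    by (simp add: algebra_simps)
  also have "\<dots> = C * (d - c) * (exp v * (1 + m - v))"
    unfolding diff_eq by (simp add: algebra_simps)
  also have "\<dots> \<le> C * (d - c) * exp m"
    using C_pos assms by (intro mult_left_mono exp_tangent_le) auto
  finally show ?thesis by (simp add: m_def)
qed

lemma log_A_inf_on_extremal: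
  assumes "0 \<le> a" "a < b"
  shows "log_A_inf_on C a b extremal"
  unfolding log_A_inf_on_def
proof (intro conjI allI impI)
  show "extremal absolutely_integrable_on {a..b}"
      "(\<lambda>t. exp (extremal t)) absolutely_integrable_on {a..b}"
    using extremal_absolutely_integrable exp_extremal_absolutely_integrable assms by auto
  fix c d assume "a \<le> c" "c < d" "d \<le> b"
  then show "integral {c..d} (\<lambda>t. exp (extremal t))
      \<le> C * (d - c) * exp (integral {c..d} extremal / (d - c))"
    using exp_extremal_primitive_diff_le[of c d] assms
    by (simp add: integral_unique[OF extremal_has_integral]
        integral_unique[OF exp_extremal_has_integral])
qed

lemma exp_extremal_in_A_inf_le: "(\<lambda>t. exp (extremal t)) \<in> A_inf_le C {0<..}"
proof (rule exp_in_A_inf_leI)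
  fix a b :: real assume "a < b" "{a<..<b} \<subseteq> {0<..}"
  then have "{a..b} \<subseteq> {0..}"
    using closure_mono[of "{a<..<b}" "{0<..}"] by (simp add: closure_greaterThan)
  then show "log_A_inf_on C a b extremal"
    using log_A_inf_on_extremal \<open>a < b\<close> by simp
qed

lemma y_le_extremal_iff: "y \<le> extremal t \<longleftrightarrow> t \<le> jump"
  using extremal_neg[of t] y_pos by (cases "t \<le> jump") (auto simp: extremal_def)

lemma tail_fraction_extremal:
  assumes s: "jump \<le> s" and lam: "extremal_primitive s = (y - lam) * s"
  shows "tail_fraction {0<..<s} extremal lam = jump / s"
proof -
  have "0 < s" using s jump_bounds by linarith
  have "extremal_primitive 0 = 0" using jump_bounds by (simp add: extremal_primitive_def)
  then have "integral {0..s} extremal = (y - lam) * (s - 0)"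
    using extremal_has_integral[of 0 s] \<open>0 < s\<close> lam by (simp add: integral_unique)
  then have "tail_fraction {0<..<s} extremal lam
      = superlevel_measure 0 s extremal (y - lam + lam) / (s - 0)"
    using \<open>0 < s\<close> extremal_absolutely_integrable[of 0 s]
    by (intro tail_fraction_interval_ends interval_ends_greaterThanLessThan) auto
  also have "{t \<in> {0..s}. y \<le> extremal t} = {0..jump}"
    using s by (auto simp: y_le_extremal_iff)
  then have "superlevel_measure 0 s extremal (y - lam + lam) = jump"
    using jump_bounds by (simp add: superlevel_measure_def)
  finally show ?thesis by simp
qed

lemma extremal_attains_linear_tail:
  assumes "0 < lam" "lam \<le> y"
  shows "\<exists>s>0. tail_fraction {0<..<s} extremal lam = 1 - lam / (x + y)"
proof -
  define D where "D = x + y - lam"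
  have D: "x \<le> D" "D < x + y" "0 < D" using assms x_pos by (auto simp: D_def)
  have "jump < x / D"
    unfolding jump_def using D x_pos y_pos by (intro divide_strict_left_mono mult_pos_pos) auto
  moreover have "x / D \<le> 1" using D by simp
  ultimately have "extremal_primitive (x / D) = x - x * (x / D)"
    by (simp add: extremal_primitive_def)
  also have "\<dots> = (y - lam) * (x / D)"
    using D(3) by (simp add: field_simps) (simp add: D_def algebra_simps)
  finally have "tail_fraction {0<..<x / D} extremal lam = jump / (x / D)"
    using \<open>jump < x / D\<close> by (intro tail_fraction_extremal) auto
  also have "\<dots> = D / (x + y)" using x_pos by (simp add: jump_def)
  also have "\<dots> = 1 - lam / (x + y)" using x_pos y_pos by (simp add: D_def diff_divide_distrib)
  finally show ?thesis using D(3) x_pos by (intro exI[of _ "x / D"]) simp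
qed

lemma extremal_attains_exponential_tail:
  assumes "y < lam"
  shows "\<exists>s>0. tail_fraction {0<..<s} extremal lam
    = x * exp (y / x) / (x + y) * exp (- lam / x)"
proof -
  define s where "s = exp ((lam - y) / x)"
  have s: "1 < s" using assms x_pos by (simp add: s_def)
  then have "extremal_primitive s = - x * ln s * s"
    using jump_bounds by (simp add: extremal_primitive_def)
  also have "- x * ln s = y - lam" using x_pos by (simp add: s_def)
  finally have "tail_fraction {0<..<s} extremal lam = jump / s"
    using s jump_bounds by (intro tail_fraction_extremal) auto
  also have "\<dots> = jump * inverse s" by (rule divide_inverse)
  also have "inverse s = exp (y / x) * exp (- lam / x)"
    by (simp add: s_def diff_divide_distrib flip: exp_add exp_minus)
  finally show ?thesis using s by (intro exI[of _ s]) (simp add: jump_def)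
qed

lemma extremal_attains_tail:
  assumes "0 < lam"
  shows "\<exists>s>0. tail_fraction {0<..<s} extremal lam = tail lam"
  using extremal_attains_linear_tail[OF assms] extremal_attains_exponential_tail[of lam]
  by (simp add: tail_def)

end

section \<open>The sharp tail bound\<close>

lemma tangent_pair_xi:
  assumes "1 < C"
  shows "tangent_pair C (xi_plus C) (- xi_minus C)"
proof
  have plus: "0 \<le> xi_plus C \<and> xi_plus C < 1 \<and> exp (- xi_plus C) = C * (1 - xi_plus C)"
    unfolding xi_plus_def by (rule theI') (use xi_plus_ex1 assms in auto)
  have minus: "xi_minus C \<le> 0 \<and> exp (- xi_minus C) = C * (1 - xi_minus C)"
    unfolding xi_minus_def by (rule theI') (use xi_minus_ex1 assms in auto)
  have "xi_plus C \<noteq> 0" "xi_minus C \<noteq> 0" using plus minus assms by auto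
  then show "0 < xi_plus C" "0 < - xi_minus C" using plus minus by auto
  show "xi_plus C < 1" "exp (- xi_plus C) = C * (1 - xi_plus C)"
    "exp (- xi_minus C) = C * (1 + - xi_minus C)" using plus minus by auto
qed

lemma tail_bound_eq_tail:
  assumes "1 < C" "0 < lam"
  shows "tail_bound C lam = tangent_pair.tail (xi_plus C) (- xi_minus C) lam"
  using assms by (simp add: tail_bound_def tangent_pair.tail_def[OF tangent_pair_xi])

lemma superlevel_measure_le_tail_bound:
  assumes "1 \<le> C" and \<phi>: "log_A_inf_on C a b \<phi>" "a < b" "integral {a..b} \<phi> = m * (b - a)"
  shows "superlevel_measure a b \<phi> (m + lam) \<le> tail_bound C lam * (b - a)"
proof -
  consider (nonpos) "lam \<le> 0" | (constant_weight) "0 < lam" "C = 1" | (pair) "0 < lam" "1 < C"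
    using \<open>1 \<le> C\<close> by linarith
  then show ?thesis
  proof cases
    case nonpos
    have "superlevel_measure a b \<phi> (m + lam) \<le> b - a"
      using log_A_inf_onD(1)[OF \<phi>(1)] \<phi>(2) by (intro superlevel_measure_le_length) auto
    then show ?thesis using nonpos by (simp add: tail_bound_def)
  next
    case constant_weight
    then have "superlevel_measure a b \<phi> (m + lam) = 0"
      using superlevel_measure_eq_0_if_constant_1 \<phi> by blast
    then show ?thesis using constant_weight by (simp add: tail_bound_def)
  next
    case pair
    then show ?thesis
      using tangent_pair.superlevel_measure_le_tail[OF tangent_pair_xi \<phi>]
      by (simp add: tail_bound_eq_tail)
  qed
qed

lemma tail_fraction_le_tail_bound:
  assumes "1 \<le> C" and weight: "(\<lambda>t. exp (\<phi> t)) \<in> A_inf_le C Q" and J: "J \<in> subintervals Q"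
  shows "tail_fraction J \<phi> lam \<le> tail_bound C lam"
proof -
  obtain a b where ends: "interval_ends J a b" and "{a<..<b} \<subseteq> Q"
    using subintervals_ends[OF J] .
  then have "a < b" and \<phi>: "log_A_inf_on C a b \<phi>"
    using interval_ends_less log_A_inf_on_if_exp_in_A_inf_le[OF weight] by blast+
  define m where "m = integral {a..b} \<phi> / (b - a)"
  have mean: "integral {a..b} \<phi> = m * (b - a)" using \<open>a < b\<close> by (simp add: m_def)
  have "superlevel_measure a b \<phi> (m + lam) \<le> tail_bound C lam * (b - a)"
    using \<open>1 \<le> C\<close> \<phi> \<open>a < b\<close> mean by (rule superlevel_measure_le_tail_bound)
  then show ?thesis
    using \<open>a < b\<close>
    by (simp add: tail_fraction_interval_ends[OF ends log_A_inf_onD(1)[OF \<phi>] mean] pos_divide_le_eq)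
qed

lemma tail_bound_attained:
  assumes C: "1 \<le> C"
  obtains Q \<phi> J where "nondegenerate_interval Q" "(\<lambda>t. exp (\<phi> t)) \<in> A_inf_le C Q"
    "J \<in> subintervals Q" "tail_fraction J \<phi> lam = tail_bound C lam"
proof (cases "lam \<le> 0 \<or> C = 1")
  case True
  have J: "{0<..<1} \<in> subintervals {0<..<1}" by (rule greaterThanLessThan_in_subintervals) auto
  show ?thesis
  proof (rule that)
    show "nondegenerate_interval {0<..<1}" using J by (simp add: subintervals_def)
    show "tail_fraction {0<..<1} (\<lambda>_. 0) lam = tail_bound C lam"
      using True tail_fraction_const[OF J] by (auto simp: tail_bound_def)
    show "(\<lambda>_. exp 0) \<in> A_inf_le C {0<..<1}"
      by (rule exp_const_in_A_inf_le[OF C])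
  qed (rule J)
next
  case False
  then have lam_pos: "0 < lam" and "1 < C" using C by auto
  interpret tangent_pair C "xi_plus C" "- xi_minus C" by (rule tangent_pair_xi) fact
  obtain s where s: "0 < s" "tail_fraction {0<..<s} extremal lam = tail lam"
    using extremal_attains_tail[OF lam_pos] by blast
  show ?thesis
  proof (rule that)
    show "nondegenerate_interval {0::real<..}"
      by (simp add: nondegenerate_interval_def is_interval_1 interior_open)
    show "{0<..<s} \<in> subintervals {0<..}"
      using s(1) by (intro greaterThanLessThan_in_subintervals) auto
  qed (use exp_extremal_in_A_inf_le s(2) tail_bound_eq_tail[OF \<open>1 < C\<close> lam_pos] in auto)
qed

theorem theorem1p9:
  fixes C :: real
  assumes "1 \<le> C"
  shows "(\<forall>Q (\<phi> :: real \<Rightarrow> real) lam J.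
            nondegenerate_interval Q \<longrightarrow> (\<lambda>t. exp (\<phi> t)) \<in> A_inf_le C Q \<longrightarrow>
            J \<in> subintervals Q \<longrightarrow>
            measure lebesgue {t \<in> J. \<phi> t - average J \<phi> \<ge> lam} / measure lebesgue J
              \<le> tail_bound C lam)
       \<and> (\<forall>lam K. K < tail_bound C lam \<longrightarrow>
            \<not> (\<forall>Q (\<phi> :: real \<Rightarrow> real) J.
                 nondegenerate_interval Q \<longrightarrow> (\<lambda>t. exp (\<phi> t)) \<in> A_inf_le C Q \<longrightarrow>
                 J \<in> subintervals Q \<longrightarrow>
                 measure lebesgue {t \<in> J. \<phi> t - average J \<phi> \<ge> lam} / measure lebesgue J
                   \<le> K))"
  unfolding tail_fraction_def[symmetric]
proof (intro conjI allI impI notI)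
  show "tail_fraction J \<phi> lam \<le> tail_bound C lam"
    if "(\<lambda>t. exp (\<phi> t)) \<in> A_inf_le C Q" "J \<in> subintervals Q" for Q \<phi> lam J
    using that by (rule tail_fraction_le_tail_bound[OF assms])
next
  fix lam K
  assume smaller: "K < tail_bound C lam"
    and bound: "\<forall>Q \<phi> J. nondegenerate_interval Q \<longrightarrow> (\<lambda>t. exp (\<phi> t)) \<in> A_inf_le C Q \<longrightarrow>
      J \<in> subintervals Q \<longrightarrow> tail_fraction J \<phi> lam \<le> K"
  obtain Q \<phi> J where "nondegenerate_interval Q" "(\<lambda>t. exp (\<phi> t)) \<in> A_inf_le C Q"
    "J \<in> subintervals Q" "tail_fraction J \<phi> lam = tail_bound C lam"
    using tail_bound_attained[OF assms] .
  with bound smaller show False by fastforce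
qed

end
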